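(* Let $B_{n,k}$ be the external profile of a random symmetric digital search tree of size $n$, with $0\le k=k(n)\le n$. Define \[ k_s:=\log_2n-\log_2\log n+\frac{\log_2\log n}{\log n}, \] \[ k_h:=\log_2n+\sqrt{2\log_2n}-\frac12\log_2\log_2n+1+\frac1{\log 2}-\frac{3\log\log n}{4\sqrt{2(\log n)(\log 2)}}. \] The mean and the variance of $B_{n,k}$ tend to infinity (as $n\to\infty$) if and only if there exists a positive sequence $\omega_n$ tending to infinity with $n$ such that \[ k_s+\frac{\omega_n}{\log n}\le k\le k_h-\frac{\omega_n}{\sqrt{\log n}}. \]
   Context: Here $\log$ is the natural logarithm and $\log_2$ the logarithm to base $2$. Random symmetric digital search tree (DST) of size $n$: one is given a sequence of $n$ records, each an infinite string of bits, all bits of all records being independent and uniform on $\{0,1\}$. If $n=0$ the tree is a single external node. If $n\ge1$, the first record is stored in the root (an internal node, at level $0$); the remaining $n-1$ records are distributed, retaining their relative order, to the left or right subtree according as their first bit is $0$ or $1$; the subtrees are built recursively by the same rule, using the next bit at each level. Thus the tree is a binary tree with $n$ internal nodes (holding the records) and $n+1$ external nodes (empty places). External profile: $B_{n,k}$ is the number of external nodes at level (distance from the root) $k$. Equivalently, $B_{0,0}=1$, $B_{0,k}=0$ for $k\ge1$, $B_{n,0}=0$ for $n\ge1$, and for $n,k\ge1$, $B_{n,k}\stackrel{d}{=}B_{J_n,k-1}+B^*_{n-1-J_n,k-1}$, where $J_n$ is Binomial$(n-1,\frac12)$, and $B^*$ is an independent copy of $B$ (both independent of $J_n$). *)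

theory Defs
  imports "HOL-Probability.Probability" "HOL-Library.Tree"
begin

type_synonym record_bits = "nat \<Rightarrow> bool"

(* dst d rs is the digital search tree of the records rs, branching on bit d at its root
   (False = left, True = right). Internal nodes are Node, external nodes are Leaf. *)
function dst :: "nat \<Rightarrow> record_bits list \<Rightarrow> record_bits tree" where
  "dst d [] = Leaf"
| "dst d (r # rs) =
     Node (dst (Suc d) (filter (\<lambda>s. \<not> s d) rs)) r (dst (Suc d) (filter (\<lambda>s. s d) rs))"
  by pat_completeness auto
termination
  by (relation "inv_image less_than (\<lambda>(d, rs). length rs)") (auto simp: le_imp_less_Suc)

fun external_nodes :: "'a tree \<Rightarrow> nat \<Rightarrow> nat" where
  "external_nodes Leaf k = (if k = 0 then 1 else 0)"
| "external_nodes (Node l x r) 0 = 0"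
| "external_nodes (Node l x r) (Suc k) = external_nodes l k + external_nodes r k"

(* A point w of the sample space gives all bits: w (i, j) is bit j of record i. *)
definition bit_space :: "(nat \<times> nat \<Rightarrow> bool) measure" where
  "bit_space = (\<Pi>\<^sub>M p\<in>UNIV. measure_pmf (bernoulli_pmf (1/2)))"

definition external_profile :: "nat \<Rightarrow> nat \<Rightarrow> (nat \<times> nat \<Rightarrow> bool) \<Rightarrow> real" where
  "external_profile n k w = real (external_nodes (dst 0 (map (\<lambda>i j. w (i, j)) [0..<n])) k)"

lemma prob_space_bit_space: "prob_space bit_space"
  unfolding bit_space_def by (intro prob_space_PiM measure_pmf.prob_space_axioms)

lemma measurable_filter_bits:
  assumes "\<And>i. i \<in> set is \<Longrightarrow> Measurable.pred bit_space (\<lambda>w. P w i)"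
  shows "(\<lambda>w. filter (P w) is) \<in> bit_space \<rightarrow>\<^sub>M count_space UNIV"
  using assms
proof (induction "is")
  case (Cons i js)
  have [measurable]: "(\<lambda>w. filter (P w) js) \<in> bit_space \<rightarrow>\<^sub>M count_space UNIV"
    "Measurable.pred bit_space (\<lambda>w. P w i)"
    using Cons by auto
  have "(\<lambda>w. i # filter (P w) js) \<in> bit_space \<rightarrow>\<^sub>M count_space UNIV"
    by (rule measurable_compose[of "\<lambda>w. filter (P w) js" _ "count_space UNIV" "\<lambda>xs. i # xs"]) auto
  then show ?case by simp
qed simp

lemma measurable_external_nodes:
  "(\<lambda>w. external_nodes (dst d (map (\<lambda>i j. w (i, j)) is)) k) \<in> bit_space \<rightarrow>\<^sub>M count_space UNIV"
proof (induction k arbitrary: d "is")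
  case 0
  show ?case by (cases "is") auto
next
  case (Suc k)
  show ?case
  proof (cases "is")
    case (Cons i js)
    have bit: "Measurable.pred bit_space (\<lambda>w. w (i, d))" for i
      unfolding bit_space_def by measurable
    have F: "(\<lambda>w. filter (\<lambda>i. w (i, d)) js) \<in> bit_space \<rightarrow>\<^sub>M count_space UNIV"
      "(\<lambda>w. filter (\<lambda>i. \<not> w (i, d)) js) \<in> bit_space \<rightarrow>\<^sub>M count_space UNIV"
      using bit by (auto intro!: measurable_filter_bits pred_intros_logic)
    have "(\<lambda>w. external_nodes (dst (Suc d) (map (\<lambda>i j. w (i, j)) (f w))) k)
        \<in> bit_space \<rightarrow>\<^sub>M count_space UNIV"
      if "f \<in> bit_space \<rightarrow>\<^sub>M count_space (UNIV :: nat list set)" for f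
      by (rule measurable_compose_countable[OF Suc that])
    from this[OF F(1)] this[OF F(2)]
    show ?thesis
      unfolding Cons by (simp add: filter_map o_def)
  qed simp
qed

lemma measurable_external_profile [measurable]: "external_profile n k \<in> borel_measurable bit_space"
  unfolding external_profile_def using measurable_external_nodes by measurable

definition k_s :: "nat \<Rightarrow> real" where
  "k_s n = log 2 (real n) - log 2 (ln (real n)) + log 2 (ln (real n)) / ln (real n)"

definition k_h :: "nat \<Rightarrow> real" where
  "k_h n = log 2 (real n) + sqrt (2 * log 2 (real n)) - 1 / 2 * log 2 (log 2 (real n))
     + 1 + 1 / ln 2 - 3 * ln (ln (real n)) / (4 * sqrt (2 * ln (real n) * ln 2))"

end

theory Submission imports Defs "HOL-Real_Asymp.Real_Asymp" begin

text \<open>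
  The external nodes at level \<open>k\<close> are counted by looking at a single path. By symmetry the mean of
  the profile is \<open>2 ^ k\<close> times the probability that, along one fixed infinite path, exactly the first
  \<open>k\<close> nodes are internal. When \<open>i\<close> nodes of the path are internal, the next record fills the next one
  with probability \<open>2 ^ -i\<close>, so this probability \<open>q n k\<close> (\<open>depth_prob\<close> below) is that of an
  approximate counter. It obeys
  \<open>q (n+1) (k+1) = (1 - 2 ^ -(k+1)) * q n (k+1) + 2 ^ -k * q n k\<close>, and everything about the mean
  follows from this recursion by elementary estimates on both sides of \<open>log 2 n\<close>.

  Lower edge. If \<open>2 ^ k\<close> is at most \<open>n / 2\<close>, the counter has typically passed \<open>k\<close>, and \<open>q n k\<close> agrees up
  to a constant factor with \<open>(1 - 2 ^ -k) ^ n\<close>, the probability of staying at \<open>k\<close>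
  (\<open>depth_prob_le_stay_power\<close>, \<open>stay_power_half_le_depth_prob\<close>). So the mean is about
  \<open>2 ^ k * exp (- n / 2 ^ k)\<close>, increasing in \<open>k\<close>, and of the order of \<open>2 powr C\<close> at
  \<open>k_s n + C / ln n\<close>.

  Upper edge. If \<open>2 ^ k\<close> exceeds \<open>n / 2\<close>, reaching \<open>k\<close> is a rare event. Choosing the times of the last
  \<open>m\<close> jumps gives the bound \<open>n ^ m / m!\<close> times the product of their probabilities \<open>2 ^ -i\<close>
  (\<open>depth_prob_le_choose\<close>). For the right \<open>m\<close>, with \<open>m * 2 ^ (k - m)\<close> of the order of \<open>n\<close>, the bound is
  sharp up to a constant factor (\<open>depth_prob_ge_power\<close>): the first \<open>k - m\<close> jumps need only a fraction
  \<open>1 / m\<close> of the time, and waiting between the last \<open>m\<close> jumps costs a constant factor. Minimising over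
  \<open>m\<close> with Stirling's formula is a quadratic problem with its minimum near \<open>m = sqrt (2 * log 2 n)\<close>
  (\<open>saddle_identity\<close>), and the minimum is of constant order exactly at \<open>k_h n\<close>. The bound is decreasing
  in \<open>k\<close> for fixed \<open>m\<close>, hence only its value at the real number
  \<open>k_h n - C / sqrt (ln n)\<close> has to be computed.

  Variance. Splitting at the root gives for the variance the recursion of the mean, with an
  additional nonnegative term (\<open>profile_var_Suc\<close>). Therefore a bound
  \<open>variance \<ge> c * mean\<close> propagates from level 3 to all higher levels. At level 3 it holds because the
  profile is integer valued with mean tending to 0, which settles large \<open>n\<close>, and random for each
  \<open>n \<ge> 3\<close>. So the variance diverges whenever the mean does, and the window is that of the mean.
\<close>

section \<open>The law of the external profile\<close>

text \<open>
  The recursion of the profile as a sampling procedure; the level comes first because the recursion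
  descends one level at a time.
\<close>

primrec profile_pmf :: "nat \<Rightarrow> nat \<Rightarrow> nat pmf" where
  "profile_pmf 0 n = return_pmf (if n = 0 then 1 else 0)"
| "profile_pmf (Suc k) n = (case n of
     0 \<Rightarrow> return_pmf 0
   | Suc m \<Rightarrow> bind_pmf (binomial_pmf m (1/2)) (\<lambda>j.
       map_pmf (\<lambda>(a, b). a + b) (pair_pmf (profile_pmf k j) (profile_pmf k (m - j)))))"

abbreviation coins :: "(nat \<times> nat) set \<Rightarrow> (nat \<times> nat \<Rightarrow> bool) pmf" where
  "coins A \<equiv> Pi_pmf A False (\<lambda>_. bernoulli_pmf (1/2))"

abbreviation tree_profile :: "nat \<Rightarrow> nat list \<Rightarrow> nat \<Rightarrow> (nat \<times> nat \<Rightarrow> bool) \<Rightarrow> nat" where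
  "tree_profile d is k w \<equiv> external_nodes (dst d (map (\<lambda>i j. w (i, j)) is)) k"

lemma tree_profile_Cons:
  "tree_profile d (i # is) (Suc k) w =
     tree_profile (Suc d) (filter (\<lambda>i. \<not> w (i, d)) is) k w + tree_profile (Suc d) (filter (\<lambda>i. w (i, d)) is) k w"
  by (simp add: filter_map o_def)

text \<open>
  Levels below \<open>d + k\<close> are the only ones that the profile at relative level \<open>k\<close> of a tree branching
  from bit \<open>d\<close> on can see. This locality yields independence of disjoint subtrees.
\<close>

lemma tree_profile_cong:
  assumes "\<And>i j. i \<in> set is \<Longrightarrow> d \<le> j \<Longrightarrow> j < d + k \<Longrightarrow> w (i, j) = w' (i, j)"
  shows "tree_profile d is k w = tree_profile d is k w'"
  using assms
proof (induction k arbitrary: d "is")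
  case 0
  then show ?case by (cases "is") auto
next
  case (Suc k)
  show ?case
  proof (cases "is")
    case (Cons i js)
    have "filter (\<lambda>i. w (i, d)) js = filter (\<lambda>i. w' (i, d)) js"
      "filter (\<lambda>i. \<not> w (i, d)) js = filter (\<lambda>i. \<not> w' (i, d)) js"
      using Suc.prems Cons by (auto intro!: filter_cong)
    moreover have "tree_profile (Suc d) (filter P js) k w = tree_profile (Suc d) (filter P js) k w'" for P
      by (rule Suc.IH) (use Suc.prems Cons in auto)
    ultimately show ?thesis
      unfolding Cons tree_profile_Cons by simp
  qed simp
qed

text \<open>
  Functions of disjoint sets of independent coins are independent.
\<close>

lemma map_coins_disjoint:
  assumes fin: "finite A" "finite B" and disj: "A \<inter> B = {}" and sub: "A \<union> B \<subseteq> C" "finite C"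
    and F: "\<And>w w'. (\<And>x. x \<in> A \<Longrightarrow> w x = w' x) \<Longrightarrow> F w = F w'"
    and G: "\<And>w w'. (\<And>x. x \<in> B \<Longrightarrow> w x = w' x) \<Longrightarrow> G w = G w'"
  shows "map_pmf (\<lambda>w. (F w, G w)) (coins C) = pair_pmf (map_pmf F (coins A)) (map_pmf G (coins B))"
proof -
  have "F (\<lambda>x. if x \<in> A \<union> B then w x else False) = F w" for w
    by (rule F) simp
  moreover have "G (\<lambda>x. if x \<in> A \<union> B then w x else False) = G w" for w
    by (rule G) simp
  ultimately have "map_pmf (\<lambda>w. (F w, G w)) (coins C) = map_pmf (\<lambda>w. (F w, G w)) (coins (A \<union> B))"
    unfolding Pi_pmf_subset[OF sub(2,1)] pmf.map_comp o_def by simp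
  also have "\<dots> = map_pmf (\<lambda>(f, g). (F f, G g)) (pair_pmf (coins A) (coins B))"
  proof -
    have "F (\<lambda>x. if x \<in> A then f x else g x) = F f" for f g
      by (rule F) simp
    moreover have "G (\<lambda>x. if x \<in> A then f x else g x) = G g" for f g
      by (rule G) (use disj in auto)
    ultimately show ?thesis
      unfolding Pi_pmf_union[OF fin disj] pmf.map_comp o_def by (simp add: case_prod_unfold)
  qed
  finally show ?thesis
    by (simp add: map_pair)
qed

text \<open>
  The first record of a nonempty list occupies the root. The coins of level \<open>d\<close> select the set \<open>S\<close> of the
  other records that go right, which has binomial size. The two subtrees read coins of later levels
  of disjoint sets of records, so given \<open>S\<close> they are independent, and independent of \<open>S\<close>. The finite set
  \<open>C\<close> of coins is left arbitrary so that the induction may pass to any coins that contain the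
  relevant ones.
\<close>

lemma map_tree_profile:
  assumes "distinct is" "set is \<times> {d..<d + k} \<subseteq> C" "finite C"
  shows "map_pmf (tree_profile d is k) (coins C) = profile_pmf k (length is)"
  using assms
proof (induction k arbitrary: d "is" C)
  case 0
  then show ?case by (cases "is") auto
next
  case (Suc k)
  show ?case
  proof (cases "is")
    case Nil
    then show ?thesis by simp
  next
    case (Cons i js)
    define A where "A = set js \<times> {d}"
    define B where "B = set js \<times> {Suc d..<Suc d + k}"
    have js: "distinct js" using Suc.prems Cons by simp
    define sel where "sel = (\<lambda>w :: nat \<times> nat \<Rightarrow> bool. {i \<in> set js. w (i, d)})"
    define T where "T = (\<lambda>S w. tree_profile (Suc d) (filter (\<lambda>i. i \<notin> S) js) k w
      + tree_profile (Suc d) (filter (\<lambda>i. i \<in> S) js) k w)"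
    have T: "tree_profile d is (Suc k) w = T (sel w) w" for w
    proof -
      have "filter (\<lambda>i. \<not> w (i, d)) js = filter (\<lambda>i. i \<notin> sel w) js"
        "filter (\<lambda>i. w (i, d)) js = filter (\<lambda>i. i \<in> sel w) js"
        by (auto simp: sel_def intro!: filter_cong)
      then show ?thesis
        unfolding Cons tree_profile_Cons T_def by simp
    qed
    have T_law: "map_pmf (T S) (coins B) =
        map_pmf (\<lambda>(a, b). a + b) (pair_pmf (profile_pmf k (card S)) (profile_pmf k (length js - card S)))"
      if S: "S \<subseteq> set js" for S
    proof -
      have fin: "finite S"
        using S by (rule finite_subset) simp
      have "map_pmf (\<lambda>w. (tree_profile (Suc d) (filter (\<lambda>i. i \<in> S) js) k w,
            tree_profile (Suc d) (filter (\<lambda>i. i \<notin> S) js) k w)) (coins B)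
          = pair_pmf (map_pmf (tree_profile (Suc d) (filter (\<lambda>i. i \<in> S) js) k) (coins (S \<times> {Suc d..<Suc d + k})))
              (map_pmf (tree_profile (Suc d) (filter (\<lambda>i. i \<notin> S) js) k) (coins ((set js - S) \<times> {Suc d..<Suc d + k})))"
        by (intro map_coins_disjoint tree_profile_cong) (use S fin in \<open>auto simp: B_def\<close>)
      also have "map_pmf (tree_profile (Suc d) (filter (\<lambda>i. i \<in> S) js) k) (coins (S \<times> {Suc d..<Suc d + k}))
          = profile_pmf k (length (filter (\<lambda>i. i \<in> S) js))"
        by (intro Suc.IH) (use js S fin in auto)
      also have "map_pmf (tree_profile (Suc d) (filter (\<lambda>i. i \<notin> S) js) k) (coins ((set js - S) \<times> {Suc d..<Suc d + k}))
          = profile_pmf k (length (filter (\<lambda>i. i \<notin> S) js))"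
        by (intro Suc.IH) (use js S fin in auto)
      finally have "map_pmf (\<lambda>(a, b). a + b) (map_pmf (\<lambda>w. (tree_profile (Suc d) (filter (\<lambda>i. i \<in> S) js) k w,
            tree_profile (Suc d) (filter (\<lambda>i. i \<notin> S) js) k w)) (coins B))
          = map_pmf (\<lambda>(a, b). a + b) (pair_pmf (profile_pmf k (length (filter (\<lambda>i. i \<in> S) js)))
              (profile_pmf k (length (filter (\<lambda>i. i \<notin> S) js))))"
        by simp
      moreover have "length (filter (\<lambda>i. i \<in> S) js) = card S"
        using js S by (simp add: distinct_length_filter Int_absorb2)
      moreover have "length (filter (\<lambda>i. i \<notin> S) js) = length js - length (filter (\<lambda>i. i \<in> S) js)"
        using sum_length_filter_compl[of "\<lambda>i. i \<in> S" js] by simp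
      ultimately show ?thesis
        by (simp add: pmf.map_comp o_def T_def add.commute)
    qed
    have "map_pmf (tree_profile d is (Suc k)) (coins C) = map_pmf (\<lambda>(S, w). T S w) (map_pmf (\<lambda>w. (sel w, \<lambda>x. x \<in> B \<and> w x)) (coins C))"
    proof -
      have "T S (\<lambda>x. x \<in> B \<and> w x) = T S w" for S w
        unfolding T_def by (intro arg_cong2[of _ _ _ _ "(+)"] tree_profile_cong) (auto simp: B_def)
      then show ?thesis
        unfolding T by (simp add: pmf.map_comp o_def)
    qed
    also have "map_pmf (\<lambda>w. (sel w, \<lambda>x. x \<in> B \<and> w x)) (coins C)
        = pair_pmf (map_pmf sel (coins A)) (map_pmf (\<lambda>w x. x \<in> B \<and> w x) (coins B))"
      using Suc.prems Cons by (intro map_coins_disjoint) (auto simp: A_def B_def sel_def)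
    also have "map_pmf (\<lambda>w x. x \<in> B \<and> w x) (coins B) = coins B"
    proof -
      have "(\<lambda>w x. x \<in> B \<and> w x) = (\<lambda>w x. if x \<in> B then w x else False)"
        by (auto simp: fun_eq_iff)
      then show ?thesis
        using Pi_pmf_subset[of B B False "\<lambda>_. bernoulli_pmf (1/2)"] by (simp add: B_def)
    qed
    also have "map_pmf (\<lambda>(S, w). T S w) (pair_pmf (map_pmf sel (coins A)) (coins B))
        = bind_pmf (map_pmf sel (coins A)) (\<lambda>S. map_pmf (T S) (coins B))"
      by (simp add: pair_pmf_def map_pmf_def bind_assoc_pmf bind_return_pmf)
    also have "\<dots> = bind_pmf (map_pmf sel (coins A)) (\<lambda>S. map_pmf (\<lambda>(a, b). a + b)
        (pair_pmf (profile_pmf k (card S)) (profile_pmf k (length js - card S))))"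
      by (intro bind_pmf_cong refl T_law) (auto simp: sel_def)
    also have "\<dots> = bind_pmf (map_pmf card (map_pmf sel (coins A))) (\<lambda>j. map_pmf (\<lambda>(a, b). a + b)
        (pair_pmf (profile_pmf k j) (profile_pmf k (length js - j))))"
      by (simp add: bind_map_pmf)
    also have "map_pmf card (map_pmf sel (coins A)) = binomial_pmf (length js) (1/2)"
    proof -
      have "binomial_pmf (length js) (1/2) = map_pmf (\<lambda>f. card {x \<in> A. f x}) (coins A)"
        using js by (intro binomial_pmf_altdef') (auto simp: A_def card_cartesian_product distinct_card)
      also have "\<dots> = map_pmf card (map_pmf sel (coins A))"
      proof -
        have "{x \<in> A. f x} = (\<lambda>i. (i, d)) ` sel f" for f
          by (auto simp: A_def sel_def)
        then have "card {x \<in> A. f x} = card (sel f)" for f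
          by (simp add: card_image inj_on_def)
        then show ?thesis by (simp add: pmf.map_comp o_def)
      qed
      finally show ?thesis by simp
    qed
    finally show ?thesis
      by (simp add: Cons)
  qed
qed


text \<open>
  The profile depends on finitely many coordinates of the infinite product space, and the projection
  to these has the law of finitely many independent fair coins.
\<close>

lemma expectation_tree_profile:
  fixes h :: "nat \<Rightarrow> real"
  shows "prob_space.expectation bit_space (\<lambda>w. h (tree_profile 0 [0..<n] k w))
           = measure_pmf.expectation (profile_pmf k n) h"
proof -
  \<comment> \<open>one row and one column more than needed, so that \<open>I\<close> is never empty\<close>
  define I :: "(nat \<times> nat) set" where "I = {0..<Suc n} \<times> {0..<Suc k}"
  have I: "finite I" "I \<noteq> {}" by (auto simp: I_def)
  define M :: "nat \<times> nat \<Rightarrow> bool measure" where "M = (\<lambda>_. measure_pmf (bernoulli_pmf (1/2)))"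
  interpret product_prob_space M UNIV
    unfolding M_def by (intro product_prob_spaceI measure_pmf.prob_space_axioms)
  define e :: "(nat \<times> nat \<Rightarrow> bool) \<Rightarrow> nat \<times> nat \<Rightarrow> bool" where "e = (\<lambda>w x. if x \<in> I then w x else False)"
  define F where "F = (\<lambda>w. h (tree_profile 0 [0..<n] k w))"
  have bs: "bit_space = PiM UNIV M"
    by (simp add: bit_space_def M_def)
  have F_meas: "F \<in> borel_measurable (PiM UNIV M)"
    unfolding F_def bs[symmetric] by (rule measurable_compose[OF measurable_external_nodes]) simp
  have e_meas: "e \<in> PiM I M \<rightarrow>\<^sub>M PiM UNIV M"
  proof (rule measurable_PiM_single')
    fix x :: "nat \<times> nat"
    show "(\<lambda>w. e w x) \<in> PiM I M \<rightarrow>\<^sub>M M x"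
      by (cases "x \<in> I") (auto simp: e_def M_def)
  qed (auto simp: M_def)
  have Fe: "F (e w) = F w" for w
    unfolding F_def by (intro arg_cong[of _ _ h] tree_profile_cong) (auto simp: e_def I_def)
  have er: "e (restrict w I) = e w" for w
    by (auto simp: e_def fun_eq_iff)
  have coins_distr: "distr (coins I) (PiM I M) (\<lambda>w. restrict w I) = PiM I M"
  proof -
    have "prob_space.indep_vars (coins I) (\<lambda>_. count_space UNIV) (\<lambda>x f. f x) I"
      by (rule indep_vars_Pi_pmf[OF I(1)])
    then have "distr (coins I) (PiM I (\<lambda>_. count_space UNIV)) (\<lambda>w. \<lambda>i\<in>I. w i)
        = PiM I (\<lambda>i. distr (coins I) (count_space UNIV) (\<lambda>w. w i))"
      by (subst (asm) prob_space.indep_vars_iff_distr_eq_PiM'[OF measure_pmf.prob_space_axioms I(2)]) auto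
    also have "\<dots> = PiM I M"
    proof (rule PiM_cong)
      fix i assume "i \<in> I"
      have "distr (coins I) (count_space UNIV) (\<lambda>w. w i) = measure_pmf (map_pmf (\<lambda>w. w i) (coins I))"
        by (simp add: map_pmf_rep_eq)
      also have "map_pmf (\<lambda>w. w i) (coins I) = bernoulli_pmf (1/2)"
        using I(1) \<open>i \<in> I\<close> by (simp add: Pi_pmf_component)
      finally show "distr (coins I) (count_space UNIV) (\<lambda>w. w i) = M i"
        by (simp add: M_def)
    qed simp
    finally have "PiM I M = distr (coins I) (PiM I (\<lambda>_. count_space UNIV)) (\<lambda>w. \<lambda>i\<in>I. w i)" by simp
    also have "\<dots> = distr (coins I) (PiM I M) (\<lambda>w. \<lambda>i\<in>I. w i)"
      by (rule distr_cong) (auto simp: M_def intro!: sets_PiM_cong)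
    finally show ?thesis by simp
  qed
  have FM: "(\<lambda>w. F (e w)) \<in> borel_measurable (PiM I M)"
    by (rule measurable_compose[OF e_meas F_meas])
  have "integral\<^sup>L bit_space F = (\<integral>w. F (e (restrict w I)) \<partial>PiM UNIV M)"
    by (simp add: bs er Fe)
  also have "\<dots> = (\<integral>w. F (e w) \<partial>distr (PiM UNIV M) (PiM I M) (\<lambda>w. restrict w I))"
    by (subst integral_distr[OF _ FM]) (auto intro!: measurable_restrict_subset)
  also have "\<dots> = (\<integral>w. F (e w) \<partial>distr (coins I) (PiM I M) (\<lambda>w. restrict w I))"
    by (subst distr_PiM_restrict_finite) (auto simp: I coins_distr)
  also have "\<dots> = measure_pmf.expectation (coins I) F"
    by (subst integral_distr[OF _ FM]) (auto simp: er Fe space_PiM M_def)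
  also have "\<dots> = measure_pmf.expectation (map_pmf (tree_profile 0 [0..<n] k) (coins I)) h"
    by (simp add: F_def)
  also have "map_pmf (tree_profile 0 [0..<n] k) (coins I) = profile_pmf k n"
    by (subst map_tree_profile) (auto simp: I_def)
  finally show ?thesis
    by (simp add: F_def)
qed

section \<open>Recursions for mean and variance\<close>

definition profile_mean :: "nat \<Rightarrow> nat \<Rightarrow> real" where
  "profile_mean k n = measure_pmf.expectation (profile_pmf k n) real"

definition profile_var :: "nat \<Rightarrow> nat \<Rightarrow> real" where
  "profile_var k n = measure_pmf.expectation (profile_pmf k n) (\<lambda>b. (real b)\<^sup>2) - (profile_mean k n)\<^sup>2"

lemma finite_profile_pmf: "finite (set_pmf (profile_pmf k n))"
  by (induction k arbitrary: n) (auto split: nat.splits)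

lemma expectation_external_profile:
  "prob_space.expectation bit_space (external_profile n k) = profile_mean k n"
  using expectation_tree_profile[of real n k] by (simp add: external_profile_def[abs_def] profile_mean_def)

lemma variance_external_profile:
  "prob_space.variance bit_space (external_profile n k) = profile_var k n"
proof -
  have "prob_space.variance bit_space (external_profile n k)
      = measure_pmf.expectation (profile_pmf k n) (\<lambda>b. (real b - profile_mean k n)\<^sup>2)"
    using expectation_tree_profile[of "\<lambda>b. (real b - profile_mean k n)\<^sup>2" n k]
    unfolding expectation_external_profile by (simp add: external_profile_def)
  also have "\<dots> = profile_var k n"
    unfolding profile_var_def profile_mean_def
    by (rule measure_pmf.variance_eq) (auto intro: integrable_measure_pmf_finite finite_profile_pmf)
  finally show ?thesis .
qed

definition binomial_mean :: "nat \<Rightarrow> (nat \<Rightarrow> real) \<Rightarrow> real" where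
  "binomial_mean n g = (\<Sum>j\<le>n. real (n choose j) / 2 ^ n * g j)"

lemma binomial_mean_0 [simp]: "binomial_mean 0 g = g 0"
  by (simp add: binomial_mean_def)

lemma binomial_mean_linear:
  "binomial_mean n (\<lambda>j. g j + h j) = binomial_mean n g + binomial_mean n h"
  "binomial_mean n (\<lambda>j. c * g j) = c * binomial_mean n g"
  by (simp_all add: binomial_mean_def sum.distrib sum_distrib_left distrib_left mult.left_commute)

lemma binomial_mean_const [simp]: "binomial_mean n (\<lambda>j. c) = c"
proof -
  have "(\<Sum>j\<le>n. real (n choose j)) = 2 ^ n"
    using choose_row_sum[of n] by (metis of_nat_numeral of_nat_power of_nat_sum)
  then show ?thesis
    by (simp add: binomial_mean_def flip: sum_distrib_right sum_divide_distrib)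
qed

lemma binomial_mean_reflect: "binomial_mean n (\<lambda>j. g (n - j)) = binomial_mean n g"
  unfolding binomial_mean_def
  by (subst sum.nat_diff_reindex[of _ "Suc n", simplified lessThan_Suc_atMost, symmetric])
     (auto intro!: sum.cong simp: binomial_symmetric[symmetric])

lemma binomial_mean_mono: "(\<And>j. j \<le> n \<Longrightarrow> g j \<le> h j) \<Longrightarrow> binomial_mean n g \<le> binomial_mean n h"
  unfolding binomial_mean_def by (intro sum_mono mult_left_mono) auto

lemma binomial_mean_pos:
  assumes "\<And>j. j \<le> n \<Longrightarrow> g j \<ge> 0" "i \<le> n" "g i > 0"
  shows "binomial_mean n g > 0"
  unfolding binomial_mean_def using assms
  by (intro sum_pos2[of _ i]) (auto intro!: mult_nonneg_nonneg mult_pos_pos)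

text \<open>
  Conditioning on the last coin: Pascal's rule.
\<close>

lemma binomial_mean_Suc: "binomial_mean (Suc n) g = (binomial_mean n g + binomial_mean n (\<lambda>j. g (Suc j))) / 2"
proof -
  have "(\<Sum>j\<le>Suc n. real (Suc n choose j) * g j) = g 0 + (\<Sum>j\<le>n. real (n choose Suc j) * g (Suc j))
      + (\<Sum>j\<le>n. real (n choose j) * g (Suc j))"
    by (subst sum.atMost_Suc_shift) (simp add: ring_distribs sum.distrib)
  also have "g 0 + (\<Sum>j\<le>n. real (n choose Suc j) * g (Suc j)) = (\<Sum>j\<le>Suc n. real (n choose j) * g j)"
    by (subst sum.atMost_Suc_shift) simp
  finally have "(\<Sum>j\<le>Suc n. real (Suc n choose j) * g j) =
      (\<Sum>j\<le>n. real (n choose j) * g j) + (\<Sum>j\<le>n. real (n choose j) * g (Suc j))"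
    by simp
  then show ?thesis
    unfolding binomial_mean_def
    by (simp add: add_divide_distrib flip: sum_divide_distrib del: sum.atMost_Suc binomial_Suc_Suc)
qed

lemma expectation_profile_Suc:
  fixes h :: "nat \<Rightarrow> real"
  shows "measure_pmf.expectation (profile_pmf (Suc k) (Suc n)) h =
    binomial_mean n (\<lambda>j. measure_pmf.expectation (pair_pmf (profile_pmf k j) (profile_pmf k (n - j))) (\<lambda>(a, b). h (a + b)))"
proof -
  have w: "pmf (binomial_pmf n (1/2)) j = real (n choose j) / 2 ^ n" if "j \<le> n" for j
  proof -
    have "(1/2 :: real) ^ j * (1/2) ^ (n - j) = (1/2) ^ n"
      using that by (simp flip: power_add)
    then show ?thesis
      by (simp add: power_one_over mult.assoc)
  qed
  have "measure_pmf.expectation (profile_pmf (Suc k) (Suc n)) h =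
      (\<Sum>j\<le>n. pmf (binomial_pmf n (1/2)) j *\<^sub>R measure_pmf.expectation
        (map_pmf (\<lambda>(a, b). a + b) (pair_pmf (profile_pmf k j) (profile_pmf k (n - j)))) h)"
    unfolding profile_pmf.simps nat.case
    by (rule pmf_expectation_bind) (auto intro!: finite_imageI finite_cartesian_product finite_profile_pmf)
  also have "\<dots> = binomial_mean n (\<lambda>j. measure_pmf.expectation (pair_pmf (profile_pmf k j) (profile_pmf k (n - j))) (\<lambda>(a, b). h (a + b)))"
    unfolding binomial_mean_def by (intro sum.cong refl) (simp add: w case_prod_unfold del: pmf_binomial)
  finally show ?thesis .
qed

lemma expectation_pair_pmf_mult:
  fixes f :: "'a \<Rightarrow> real" and g :: "'b \<Rightarrow> real"
  assumes "finite (set_pmf p)" "finite (set_pmf q)"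
  shows "measure_pmf.expectation (pair_pmf p q) (\<lambda>x. f (fst x) * g (snd x))
    = measure_pmf.expectation p f * measure_pmf.expectation q g"
proof -
  have "measure_pmf.expectation (pair_pmf p q) (\<lambda>x. f (fst x) * g (snd x))
      = (\<Sum>a\<in>set_pmf p. pmf p a *\<^sub>R measure_pmf.expectation (map_pmf (Pair a) q) (\<lambda>x. f (fst x) * g (snd x)))"
    unfolding pair_pmf_def map_pmf_def[symmetric]
    by (rule pmf_expectation_bind) (use assms in auto)
  also have "\<dots> = (\<Sum>a\<in>set_pmf p. f a * pmf p a) * measure_pmf.expectation q g"
    by (simp add: sum_distrib_right mult.assoc mult.left_commute)
  also have "(\<Sum>a\<in>set_pmf p. f a * pmf p a) = measure_pmf.expectation p f"
    by (rule integral_measure_pmf_real[symmetric]) (use assms in auto)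
  finally show ?thesis .
qed

lemma profile_mean_Suc_pair:
  "profile_mean (Suc k) (Suc n) = binomial_mean n (\<lambda>j. profile_mean k j + profile_mean k (n - j))"
  unfolding profile_mean_def expectation_profile_Suc
  by (simp add: case_prod_unfold integrable_measure_pmf_finite finite_profile_pmf)

lemma profile_mean_Suc: "profile_mean (Suc k) (Suc n) = 2 * binomial_mean n (profile_mean k)"
  unfolding profile_mean_Suc_pair binomial_mean_linear binomial_mean_reflect by simp

text \<open>
  The law of total variance, conditioning on the number of records in the left subtree: the two
  subtrees contribute their variances, and the conditional mean contributes its own.
\<close>

lemma profile_var_Suc:
  "profile_var (Suc k) (Suc n) = 2 * binomial_mean n (profile_var k)
     + binomial_mean n (\<lambda>j. (profile_mean k j + profile_mean k (n - j) - profile_mean (Suc k) (Suc n))\<^sup>2)"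
proof -
  define M where "M = profile_mean (Suc k) (Suc n)"
  define c where "c = (\<lambda>j. profile_mean k j + profile_mean k (n - j))"
  have "measure_pmf.expectation (pair_pmf (profile_pmf k j) (profile_pmf k (n - j))) (\<lambda>(a, b). (real (a + b))\<^sup>2)
      = profile_var k j + profile_var k (n - j) + (c j)\<^sup>2" for j
  proof -
    have "measure_pmf.expectation (pair_pmf (profile_pmf k j) (profile_pmf k (n - j))) (\<lambda>(a, b). (real (a + b))\<^sup>2)
      = measure_pmf.expectation (pair_pmf (profile_pmf k j) (profile_pmf k (n - j)))
          (\<lambda>x. (real (fst x))\<^sup>2 + (real (snd x))\<^sup>2 + 2 * (real (fst x) * real (snd x)))"
      by (simp add: case_prod_unfold power2_sum mult.assoc)
    also have "\<dots> = measure_pmf.expectation (profile_pmf k j) (\<lambda>b. (real b)\<^sup>2)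
        + measure_pmf.expectation (profile_pmf k (n - j)) (\<lambda>b. (real b)\<^sup>2) + 2 * (profile_mean k j * profile_mean k (n - j))"
      using expectation_pair_pmf_fst[of "profile_pmf k j" "profile_pmf k (n - j)" "\<lambda>b. (real b)\<^sup>2"]
        expectation_pair_pmf_snd[of "profile_pmf k j" "profile_pmf k (n - j)" "\<lambda>b. (real b)\<^sup>2"]
      by (simp add: integrable_measure_pmf_finite finite_profile_pmf
           expectation_pair_pmf_mult profile_mean_def)
    finally show ?thesis
      by (simp add: profile_var_def c_def power2_sum)
  qed
  then have "measure_pmf.expectation (profile_pmf (Suc k) (Suc n)) (\<lambda>b. (real b)\<^sup>2)
      = binomial_mean n (\<lambda>j. profile_var k j + profile_var k (n - j) + (c j)\<^sup>2)"
    unfolding expectation_profile_Suc by simp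
  also have "\<dots> = 2 * binomial_mean n (profile_var k) + binomial_mean n (\<lambda>j. (c j)\<^sup>2)"
    unfolding binomial_mean_linear binomial_mean_reflect by simp
  finally have 1: "profile_var (Suc k) (Suc n)
      = 2 * binomial_mean n (profile_var k) + (binomial_mean n (\<lambda>j. (c j)\<^sup>2) - M\<^sup>2)"
    by (simp add: profile_var_def M_def)
  have "binomial_mean n (\<lambda>j. (c j - M)\<^sup>2) = binomial_mean n (\<lambda>j. (c j)\<^sup>2 + (M\<^sup>2 + (- 2 * M) * c j))"
    by (intro arg_cong[of _ _ "binomial_mean n"] ext) (simp add: power2_diff)
  also have "\<dots> = binomial_mean n (\<lambda>j. (c j)\<^sup>2) + (M\<^sup>2 + (- 2 * M) * binomial_mean n c)"
    unfolding binomial_mean_linear by simp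
  also have "binomial_mean n c = M"
    by (simp add: M_def c_def profile_mean_Suc_pair)
  finally show ?thesis
    using 1 by (simp add: c_def M_def power2_eq_square)
qed

section \<open>A single path: approximate counting\<close>

text \<open>
  A fixed path from the root has a number of internal nodes that starts at 0 and, when it is \<open>i\<close>,
  increases with probability \<open>2 ^ -i\<close> at each new record, since a record continues along the path
  with probability 1/2 at each of the \<open>i\<close> nodes. The value \<open>depth_prob n k\<close> is the probability that it
  equals \<open>k\<close> after \<open>n\<close> records. This is Morris's approximate counter with base 2.
\<close>

fun depth_prob :: "nat \<Rightarrow> nat \<Rightarrow> real" where
  "depth_prob 0 0 = 1"
| "depth_prob 0 (Suc k) = 0"
| "depth_prob (Suc n) 0 = 0"
| "depth_prob (Suc n) (Suc k) =
     (1 - (1/2) ^ Suc k) * depth_prob n (Suc k) + (1/2) ^ k * depth_prob n k"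

abbreviation stay :: "nat \<Rightarrow> real" where
  "stay i \<equiv> 1 - (1/2) ^ i"

lemma half_power_le_1: "(1/2 :: real) ^ i \<le> 1"
  by (simp add: power_le_one)

lemma half_power_le_half: "a \<ge> 1 \<Longrightarrow> (1/2 :: real) ^ a \<le> 1/2"
  using power_decreasing[of 1 a "1/2 :: real"] by simp

lemma stay_nonneg: "stay i \<ge> 0"
  using half_power_le_1[of i] by simp

lemma stay_ge_half: "i \<ge> 1 \<Longrightarrow> stay i \<ge> 1/2"
  using power_decreasing[of 1 i "1/2 :: real"] by simp

lemma depth_prob_nonneg: "depth_prob n k \<ge> 0"
  by (induction n k rule: depth_prob.induct)
     (use stay_nonneg in \<open>auto intro!: add_nonneg_nonneg mult_nonneg_nonneg simp del: power_Suc\<close>)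

text \<open>
  In one step, mass leaves \<open>{..m}\<close> only by a jump from \<open>m\<close>.
\<close>

lemma sum_depth_prob_Suc:
  "(\<Sum>k\<le>m. depth_prob (Suc n) k) = (\<Sum>k\<le>m. depth_prob n k) - (1/2) ^ m * depth_prob n m"
  by (induction m) (auto simp: algebra_simps)

lemma sum_depth_prob_le_1: "(\<Sum>k\<le>m. depth_prob n k) \<le> 1"
proof (induction n arbitrary: m)
  case 0
  have "(\<Sum>k\<le>m. depth_prob 0 k) = (\<Sum>k\<le>m. if k = 0 then 1 else 0)"
    by (intro sum.cong refl) (auto simp: gr0_conv_Suc)
  then show ?case by simp
next
  case (Suc n)
  show ?case
    using sum_depth_prob_Suc[of n m] Suc[of m] mult_nonneg_nonneg[OF zero_le_power[of "1/2 :: real" m] depth_prob_nonneg[of n m]]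
    by simp
qed

lemma depth_prob_le_1: "depth_prob n k \<le> 1"
  using sum_depth_prob_le_1[of n k] member_le_sum[of k "{..k}" "depth_prob n"] depth_prob_nonneg
  by force

text \<open>
  The recursion turns into an identity between the generating functions at \<open>k\<close> and \<open>k + 1\<close>; for partial
  sums it becomes an inequality, which spares any discussion of convergence.
\<close>

lemma weighted_sum_le:
  assumes "z \<ge> 0" "stay (Suc k) * z < 1"
  shows "(1 - stay (Suc k) * z) * (\<Sum>n\<le>N. depth_prob n (Suc k) * z ^ n)
           \<le> (1/2) ^ k * z * (\<Sum>n\<le>N. depth_prob n k * z ^ n)"
proof -
  define G where "G = (\<lambda>k. \<Sum>n\<le>N. depth_prob n k * z ^ n)"
  have "G (Suc k) \<le> (\<Sum>n\<le>Suc N. depth_prob n (Suc k) * z ^ n)"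
    unfolding G_def using assms depth_prob_nonneg[of "Suc N" "Suc k"] by (simp del: depth_prob.simps)
  also have "\<dots> = stay (Suc k) * z * G (Suc k) + (1/2) ^ k * z * G k"
  proof -
    have "(\<Sum>n\<le>Suc N. depth_prob n (Suc k) * z ^ n) = (\<Sum>n\<le>N. depth_prob (Suc n) (Suc k) * z ^ Suc n)"
      by (subst sum.atMost_Suc_shift) simp
    also have "\<dots> = (\<Sum>n\<le>N. stay (Suc k) * z * (depth_prob n (Suc k) * z ^ n)
        + (1/2) ^ k * z * (depth_prob n k * z ^ n))"
      by (intro sum.cong refl) (simp add: algebra_simps)
    finally show ?thesis
      by (simp add: G_def sum.distrib sum_distrib_left)
  qed
  finally show ?thesis
    unfolding G_def by (simp add: algebra_simps)
qed

lemma weighted_sum_le_prod: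
  assumes z: "z \<ge> 0" "stay k * z < 1"
  shows "(\<Sum>n\<le>N. depth_prob n k * z ^ n) * (\<Prod>i<k. 1 - stay (Suc i) * z) \<le> (\<Prod>i<k. (1/2) ^ i * z)"
  using z(2)
proof (induction k)
  case 0
  have "(\<Sum>n\<le>N. depth_prob n 0 * z ^ n) = (\<Sum>n\<le>N. if n = 0 then 1 else 0)"
    by (intro sum.cong refl) (auto simp: gr0_conv_Suc)
  then show ?case by simp
next
  case (Suc k)
  have le: "stay i * z < 1" if "i \<le> Suc k" for i
  proof -
    have "stay i \<le> stay (Suc k)"
      using that by (simp add: power_decreasing del: power_Suc)
    then show ?thesis
      using Suc.prems z(1) mult_right_mono[of "stay i" "stay (Suc k)" z] by linarith
  qed
  have pos: "(\<Prod>i<k. 1 - stay (Suc i) * z) \<ge> 0"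
    by (intro prod_nonneg) (use le in \<open>force intro: less_imp_le simp del: power_Suc\<close>)
  have "(\<Sum>n\<le>N. depth_prob n (Suc k) * z ^ n) * (\<Prod>i<Suc k. 1 - stay (Suc i) * z)
      = ((1 - stay (Suc k) * z) * (\<Sum>n\<le>N. depth_prob n (Suc k) * z ^ n)) * (\<Prod>i<k. 1 - stay (Suc i) * z)"
    by (simp add: mult_ac)
  also have "\<dots> \<le> ((1/2) ^ k * z * (\<Sum>n\<le>N. depth_prob n k * z ^ n)) * (\<Prod>i<k. 1 - stay (Suc i) * z)"
    by (intro mult_right_mono weighted_sum_le pos Suc.prems z)
  also have "\<dots> = (1/2) ^ k * z * ((\<Sum>n\<le>N. depth_prob n k * z ^ n) * (\<Prod>i<k. 1 - stay (Suc i) * z))"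
    by simp
  also have "\<dots> \<le> (1/2) ^ k * z * (\<Prod>i<k. (1/2) ^ i * z)"
    by (intro mult_left_mono Suc.IH le) (use z in auto)
  finally show ?case
    by (simp add: mult_ac)
qed

text \<open>
  The partial products decrease to about 0.289. The induction needs the stronger bound
  \<open>1/4 + 2 ^ -(k + 1)\<close>.
\<close>

lemma euler_prod_ge: "(\<Prod>i<k. stay (Suc i)) \<ge> 1/4"
proof (cases k)
  case (Suc m)
  have "(\<Prod>i<Suc m. stay (Suc i)) \<ge> 1/4 + (1/2) ^ Suc m / 2"
  proof (induction m)
    case (Suc m)
    define x :: real where "x = (1/2) ^ Suc m"
    have x: "0 \<le> x" "x \<le> 1/2"
      using power_decreasing[of 1 "Suc m" "1/2 :: real"] by (auto simp: x_def)
    have "1/4 + x/4 \<le> (1/4 + x/2) * (1 - x/2)"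
      using x mult_nonneg_nonneg[of x "1/2 - x"] by (simp add: field_simps)
    also have "\<dots> \<le> (\<Prod>i<Suc m. stay (Suc i)) * (1 - x/2)"
      using Suc.IH x by (intro mult_right_mono) (auto simp: x_def)
    finally show ?case
      by (simp add: x_def)
  qed simp
  then show ?thesis
    using zero_le_power[of "1/2 :: real" "Suc m"] unfolding Suc by linarith
qed simp

text \<open>
  Decompose according to the time at which state \<open>k\<close> is entered. The path then stays there, which
  accounts for the factor \<open>stay k ^ n\<close> and leaves the generating function of the entrance time at
  \<open>z = 1 / stay k\<close>. The product bound for it collapses to the reciprocal of
  \<open>(1 - 1/2) * (1 - 1/4) * \<dots> * (1 - 2 ^ -k)\<close>.
\<close>

lemma depth_prob_le_stay_power: "depth_prob n k \<le> 4 * stay k ^ n"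
proof (cases k)
  case 0
  then show ?thesis by (cases n) auto
next
  case (Suc j)
  define lam where "lam = stay k"
  define z where "z = 1 / lam"
  have lam: "lam > 0"
    using stay_ge_half[of k] Suc by (simp add: lam_def del: power_Suc)
  have z: "z > 0" "lam * z = 1"
    using lam by (auto simp: z_def)
  \<comment> \<open>the factors of the denominator at \<open>z = 1 / stay k\<close>; they produce the powers of 1/2 in the numerator\<close>
  have stay_z: "1 - stay i * z = (1/2) ^ i * z * stay (k - i)" if "i \<le> k" for i
  proof -
    have "(1/2 :: real) ^ k = (1/2) ^ i * (1/2) ^ (k - i)"
      using that by (simp flip: power_add)
    moreover have "1 - stay i * z = (lam - stay i) * z"
      using z by (simp add: left_diff_distrib)
    ultimately show ?thesis
      unfolding lam_def by (simp add: algebra_simps)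
  qed
  have pos: "(1/2) ^ i * z > 0" for i :: nat
    using z by simp
  have "stay j * z < 1"
    using stay_z[of j] pos[of j] Suc by simp
  define H where "H = (\<lambda>N. \<Sum>n\<le>N. depth_prob n j * z ^ n)"
  have H: "H N * (\<Prod>i<j. stay (Suc i)) * (1/2) ^ j \<le> 1" for N
  proof -
    have "(\<Prod>i<j. 1 - stay (Suc i) * z) = (\<Prod>i<j. (1/2) ^ Suc i * z) * (\<Prod>i<j. stay (j - i))"
      unfolding prod.distrib[symmetric]
      by (intro prod.cong refl) (subst stay_z, auto simp: Suc)
    also have "(\<Prod>i<j. stay (j - i)) = (\<Prod>i<j. stay (Suc i))"
      by (subst prod.nat_diff_reindex[symmetric])
         (auto intro!: prod.cong simp: Suc_diff_Suc simp del: power_Suc)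
    finally have e: "(\<Prod>i<j. 1 - stay (Suc i) * z) =
        (\<Prod>i<j. (1/2) ^ Suc i * z) * (\<Prod>i<j. stay (Suc i))" .
    have "(\<Prod>i<j. (1/2) ^ Suc i * z) * z = (\<Prod>i<Suc j. (1/2) ^ i * z)"
      by (subst prod.lessThan_Suc_shift) simp
    then have e2: "(\<Prod>i<j. (1/2) ^ Suc i * z) = (\<Prod>i<j. (1/2) ^ i * z) * (1/2) ^ j"
      using z by (simp add: mult_ac)
    have "H N * (\<Prod>i<j. 1 - stay (Suc i) * z) \<le> (\<Prod>i<j. (1/2) ^ i * z)"
      unfolding H_def by (rule weighted_sum_le_prod) (use z \<open>stay j * z < 1\<close> in auto)
    then have "(H N * (\<Prod>i<j. stay (Suc i)) * (1/2) ^ j) * (\<Prod>i<j. (1/2) ^ i * z)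
        \<le> 1 * (\<Prod>i<j. (1/2) ^ i * z)"
      unfolding e e2 by (simp add: mult_ac)
    moreover have "(\<Prod>i<j. (1/2) ^ i * z) > 0"
      by (intro prod_pos) (use pos in auto)
    ultimately show ?thesis
      by (rule mult_right_le_imp_le)
  qed
  have step: "depth_prob m k = lam ^ m * ((1/2) ^ j * z * (\<Sum>i<m. depth_prob i j * z ^ i))" for m
  proof (induction m)
    case (Suc m)
    have "lam ^ m * z ^ m = 1"
      using z(2) by (simp flip: power_mult_distrib)
    moreover have "lam ^ Suc m * ((1/2) ^ j * z * (depth_prob m j * z ^ m))
        = (lam * z) * (lam ^ m * z ^ m) * ((1/2) ^ j * depth_prob m j)"
      by (simp only: power_Suc mult_ac)
    ultimately have "lam ^ Suc m * ((1/2) ^ j * z * (depth_prob m j * z ^ m)) = (1/2) ^ j * depth_prob m j"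
      using z(2) by simp
    moreover have "depth_prob (Suc m) k = lam * depth_prob m k + (1/2) ^ j * depth_prob m j"
      by (simp add: lam_def \<open>k = Suc j\<close>)
    ultimately show ?case
      unfolding Suc.IH sum.lessThan_Suc by (simp only: power_Suc distrib_left mult_ac)
  qed (use \<open>k = Suc j\<close> in simp)
  show ?thesis
  proof (cases n)
    case 0
    then show ?thesis using depth_prob_le_1[of 0 k] by simp
  next
    case (Suc m)
    have "{..<n} = {..m}" using Suc by auto
    then have "depth_prob n k = lam ^ n * (z * ((1/2) ^ j * H m))"
      by (subst step) (simp add: H_def mult_ac)
    also have "z * ((1/2) ^ j * H m) \<le> 4"
    proof -
      have "(\<Prod>i<j. stay (Suc i)) * lam \<ge> 1/4"
        using euler_prod_ge[of k] \<open>k = Suc j\<close> by (simp add: lam_def)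
      moreover have "H m \<ge> 0"
        unfolding H_def using depth_prob_nonneg z by (auto intro!: sum_nonneg)
      ultimately have "(1/4) * (z * ((1/2) ^ j * H m)) \<le> ((\<Prod>i<j. stay (Suc i)) * lam) * (z * ((1/2) ^ j * H m))"
        using z by (intro mult_right_mono) auto
      also have "\<dots> = H m * (\<Prod>i<j. stay (Suc i)) * (1/2) ^ j * (lam * z)"
        by (simp add: mult_ac)
      also have "\<dots> \<le> 1"
        unfolding z(2) using H[of m] by simp
      finally show ?thesis by linarith
    qed
    finally show ?thesis
      using lam by (simp add: lam_def mult_ac)
  qed
qed

text \<open>
  Whoever has reached state \<open>a\<close> by time \<open>n\<close> would be found there if no jump from \<open>a\<close> occurred at any of
  the \<open>n\<close> steps. The sum in the statement is the probability of not having reached \<open>a\<close>.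
\<close>

lemma stay_power_mult_tail_le: "stay a ^ n * (1 - (\<Sum>j<a. depth_prob n j)) \<le> depth_prob n a"
proof (cases a)
  case 0
  then show ?thesis by (cases n) auto
next
  case (Suc b)
  have "stay a ^ n * (1 - (\<Sum>j\<le>b. depth_prob n j)) \<le> depth_prob n a"
  proof (induction n)
    case 0
    have "(\<Sum>j\<le>b. depth_prob 0 j) = (\<Sum>j\<le>b. if j = 0 then 1 else 0)"
      by (intro sum.cong refl) (auto simp: gr0_conv_Suc)
    then show ?case using Suc by simp
  next
    case (Suc n)
    define p where "p = (1/2) ^ b * depth_prob n b"
    have "stay a ^ Suc n * (1 - (\<Sum>j\<le>b. depth_prob (Suc n) j))
        = stay a * (stay a ^ n * (1 - (\<Sum>j\<le>b. depth_prob n j))) + stay a ^ Suc n * p"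
      unfolding sum_depth_prob_Suc p_def by (simp add: algebra_simps)
    also have "\<dots> \<le> stay a * depth_prob n a + 1 * p"
      using Suc.IH depth_prob_nonneg[of n b] stay_nonneg[of a]
      by (intro add_mono mult_left_mono mult_right_mono power_le_one) (auto simp: p_def)
    finally show ?case
      by (simp add: p_def \<open>a = Suc b\<close>)
  qed
  then show ?thesis
    by (simp add: Suc lessThan_Suc_atMost)
qed

lemma stay_le_exp: "stay i \<le> exp (- ((1/2) ^ i))"
  using exp_ge_add_one_self[of "- ((1/2) ^ i)"] by simp

lemma exp_le_one_minus:
  fixes x :: real
  assumes "0 \<le> x" "x \<le> 1/2"
  shows "exp (- x - 2 * x\<^sup>2) \<le> 1 - x"
  using ln_one_minus_pos_lower_bound[OF assms] assms by (simp add: ln_ge_iff)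

text \<open>
  By the upper bound, the states below \<open>a\<close> have total probability at most 1/2 once \<open>n\<close> is twice \<open>2 ^ a\<close>,
  since the bounds \<open>4 * exp (- n / 2 ^ j)\<close> decay doubly exponentially as \<open>j\<close> decreases.
\<close>

lemma stay_power_half_le_depth_prob:
  assumes "2 * 2 ^ a \<le> n"
  shows "stay a ^ n / 2 \<le> depth_prob n a"
proof -
  have "(\<Sum>j<a. depth_prob n j) = (\<Sum>i<a. depth_prob n (a - Suc i))"
    by (rule sum.nat_diff_reindex[symmetric])
  also have "\<dots> \<le> (\<Sum>i<a. (1/2) ^ (i + 2))"
  proof (rule sum_mono)
    fix i assume i: "i \<in> {..<a}"
    define j where "j = a - Suc i"
    have "depth_prob n j \<le> 4 * stay j ^ n"
      by (rule depth_prob_le_stay_power)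
    also have "stay j ^ n \<le> exp (- ((1/2) ^ j)) ^ n"
      by (intro power_mono stay_le_exp stay_nonneg)
    also have "\<dots> = exp (- (real n * (1/2) ^ j))"
      by (simp flip: exp_of_nat_mult)
    also have "real n * (1/2) ^ j \<ge> real (i + 4)"
    proof -
      have "i + 4 \<le> 2 * 2 ^ Suc i"
        by (induction i) auto
      then have "(i + 4) * 2 ^ j \<le> 2 * 2 ^ Suc i * 2 ^ j"
        by (rule mult_right_mono) simp
      also have "(2::nat) * 2 ^ Suc i * 2 ^ j = 2 * 2 ^ a"
        using i by (simp add: j_def flip: power_add power_Suc)
      also have "\<dots> \<le> n" by fact
      finally have "real ((i + 4) * 2 ^ j) \<le> real n"
        by (rule of_nat_mono)
      then show ?thesis
        by (simp add: field_simps power_one_over)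
    qed
    then have "exp (- (real n * (1/2) ^ j)) \<le> exp (- real (i + 4))"
      by simp
    also have "\<dots> = exp (-1) ^ (i + 4)"
      by (simp flip: exp_of_nat_mult)
    also have "\<dots> \<le> (1/2) ^ (i + 4)"
      using exp_ge_add_one_self[of 1] by (intro power_mono) (auto simp: exp_minus field_simps)
    finally show "depth_prob n (a - Suc i) \<le> (1/2) ^ (i + 2)"
      by (simp add: j_def power_add power_divide)
  qed
  also have "(\<Sum>i<a. (1/2 :: real) ^ (i + 2)) = (1 - (1/2) ^ a) / 2"
    by (induction a) (auto simp: field_simps)
  also have "\<dots> \<le> 1/2"
    by simp
  finally have "1/2 \<le> 1 - (\<Sum>j<a. depth_prob n j)"
    by simp
  then have "stay a ^ n * (1/2) \<le> stay a ^ n * (1 - (\<Sum>j<a. depth_prob n j))"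
    using stay_nonneg by (intro mult_left_mono) auto
  then show ?thesis
    using stay_power_mult_tail_le[of a n] by simp
qed

lemma profile_mean_0_right [simp]: "profile_mean k 0 = (if k = 0 then 1 else 0)"
  by (cases k) (auto simp: profile_mean_def)

lemma profile_mean_0_left [simp]: "profile_mean 0 n = (if n = 0 then 1 else 0)"
  by (simp add: profile_mean_def)

text \<open>
  The mean recursion splits at the root, that is, at the first record; the counter recursion splits
  at the last record. Pascal's rule translates one into the other.
\<close>

lemma profile_mean_Suc_Suc:
  "profile_mean (Suc k) (Suc n) / 2 ^ Suc k =
     stay (Suc k) * (profile_mean (Suc k) n / 2 ^ Suc k) + (1/2) ^ k * (profile_mean k n / 2 ^ k)"
proof (induction k arbitrary: n)
  case 0
  show ?case
  proof (cases n)
    case (Suc m)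
    have [simp]: "profile_mean 0 = (\<lambda>n. if n = 0 then 1 else 0)"
      by (simp add: fun_eq_iff)
    have "binomial_mean (Suc m) (profile_mean 0) = binomial_mean m (profile_mean 0) / 2"
      by (subst binomial_mean_Suc) simp
    then show ?thesis
      unfolding Suc profile_mean_Suc by simp
  qed (simp add: profile_mean_Suc)
next
  case (Suc k)
  define g where "g = (\<lambda>k n. profile_mean k n / 2 ^ k)"
  have g_Suc: "g (Suc k) (Suc n) = binomial_mean n (g k)" for k n
    using binomial_mean_linear(2)[of n "1 / 2 ^ k" "profile_mean k"]
    by (simp add: g_def profile_mean_Suc)
  have IH: "g (Suc k) (Suc n) = stay (Suc k) * g (Suc k) n + (1/2) ^ k * g k n" for n
    using Suc[of n] by (simp only: g_def)
  have "g (Suc (Suc k)) (Suc n) = stay (Suc (Suc k)) * g (Suc (Suc k)) n + (1/2) ^ Suc k * g (Suc k) n"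
  proof (cases n)
    case 0
    then show ?thesis
      unfolding 0 g_Suc by (simp add: g_def)
  next
    case (Suc m)
    have "g (Suc (Suc k)) (Suc n) = (binomial_mean m (g (Suc k)) + binomial_mean m (\<lambda>j. g (Suc k) (Suc j))) / 2"
      unfolding Suc g_Suc binomial_mean_Suc by simp
    also have "\<dots> = (binomial_mean m (g (Suc k)) + (stay (Suc k) * binomial_mean m (g (Suc k)) + (1/2) ^ k * binomial_mean m (g k))) / 2"
      unfolding IH binomial_mean_linear by simp
    also have "\<dots> = stay (Suc (Suc k)) * g (Suc (Suc k)) n + (1/2) ^ Suc k * g (Suc k) n"
      unfolding Suc g_Suc by (simp add: field_simps)
    finally show ?thesis .
  qed
  then show ?case
    by (simp only: g_def)
qed

lemma profile_mean_eq: "profile_mean k n = 2 ^ k * depth_prob n k"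
proof -
  have "profile_mean k n / 2 ^ k = depth_prob n k"
  proof (induction n k rule: depth_prob.induct)
    case (4 n k)
    then show ?case
      unfolding profile_mean_Suc_Suc by simp
  qed auto
  then show ?thesis
    by (simp add: field_simps)
qed

lemma profile_mean_nonneg: "profile_mean k n \<ge> 0"
  by (simp add: profile_mean_eq depth_prob_nonneg)

section \<open>The variance is at least proportional to the mean\<close>

lemma profile_var_nonneg: "profile_var k n \<ge> 0"
  using variance_external_profile[of n k] prob_space.variance_positive[OF prob_space_bit_space]
  by metis

text \<open>
  A random variable \<open>B\<close> with natural values satisfies \<open>B \<le> B\<^sup>2\<close>.
\<close>

lemma profile_var_ge: "profile_var k n \<ge> profile_mean k n * (1 - profile_mean k n)"
proof -
  have "profile_mean k n \<le> measure_pmf.expectation (profile_pmf k n) (\<lambda>b. (real b)\<^sup>2)"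
    unfolding profile_mean_def
  proof (rule integral_mono)
    fix b :: nat
    have "b \<le> b\<^sup>2"
      by (simp add: power2_eq_square)
    then show "real b \<le> (real b)\<^sup>2"
      using of_nat_mono by fastforce
  qed (auto intro: integrable_measure_pmf_finite finite_profile_pmf)
  then show ?thesis
    by (simp add: profile_var_def power2_eq_square algebra_simps)
qed

lemma profile_var_Suc_ge: "profile_var (Suc k) (Suc n) \<ge> 2 * binomial_mean n (profile_var k)"
  unfolding profile_var_Suc using binomial_mean_mono[of n "\<lambda>_. 0"] by simp

lemma profile_var_pos_Suc:
  assumes "profile_var k j > 0" "j \<le> n"
  shows "profile_var (Suc k) (Suc n) > 0"
  using profile_var_Suc_ge[where k = k and n = n] binomial_mean_pos[of n "profile_var k" j]
    assms profile_var_nonneg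
  by force

text \<open>
  If two sizes of the left subtree lead to different conditional means, then the conditional mean
  is not constant and contributes to the variance.
\<close>

lemma profile_var_pos_split:
  assumes "i \<le> n" "j \<le> n"
    and "profile_mean k i + profile_mean k (n - i) \<noteq> profile_mean k j + profile_mean k (n - j)"
  shows "profile_var (Suc k) (Suc n) > 0"
proof -
  define c where "c = (\<lambda>j. profile_mean k j + profile_mean k (n - j) - profile_mean (Suc k) (Suc n))"
  obtain l where l: "l \<le> n" "c l \<noteq> 0"
    using assms by (metis c_def right_minus_eq)
  have "binomial_mean n (\<lambda>j. (c j)\<^sup>2) > 0"
    by (rule binomial_mean_pos[of _ _ l]) (use l in auto)
  moreover have "binomial_mean n (profile_var k) \<ge> 0"
    using binomial_mean_mono[of n "\<lambda>_. 0" "profile_var k"] profile_var_nonneg by simp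
  ultimately show ?thesis
    unfolding profile_var_Suc c_def by linarith
qed

text \<open>
  Level 3 is the first one that works: with three records, both levels 2 and 3 have a random profile
  because the split at the root, 1 and 1 or 2 and 0, changes the mean. Larger trees have a
  left subtree of size 3 with positive probability. Level 2 fails, as the tree of two records has a
  deterministic but nonzero profile there.
\<close>

lemma profile_var_3_pos:
  assumes "n \<ge> 3"
  shows "profile_var 3 n > 0"
proof -
  have e: "3 = Suc (Suc (Suc 0))" by simp
  have two: "profile_var (Suc (Suc 0)) 3 > 0"
    unfolding e by (rule profile_var_pos_split[of 0 _ 1]) (auto simp: profile_mean_eq)
  show ?thesis
  proof (cases "n = 3")
    case True
    then show ?thesis
      unfolding True e by (intro profile_var_pos_split[of 0 _ 1]) (auto simp: profile_mean_eq)
  next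
    case False
    then obtain m where "n = Suc m" "3 \<le> m"
      using assms by (cases n) auto
    then show ?thesis
      using profile_var_pos_Suc[OF two] by (simp add: e)
  qed
qed

text \<open>
  The mean at level 3 tends to 0 exponentially fast, so for large \<open>n\<close> the factor \<open>1 - mean\<close> in
  \<open>profile_var_ge\<close> is at least 1/2. The remaining \<open>n\<close> are finitely many; for \<open>n < 3\<close> the mean vanishes.
\<close>

lemma profile_var_3_ge: "\<exists>c>0. \<forall>n. c * profile_mean 3 n \<le> profile_var 3 n"
proof -
  have lim: "(\<lambda>n. 32 * (7/8 :: real) ^ n) \<longlonglongrightarrow> 0"
    by real_asymp
  then have "\<forall>\<^sub>F n in sequentially. 32 * (7/8 :: real) ^ n < 1/2"
    by (rule order_tendstoD) simp
  then obtain N where N: "\<And>n. n \<ge> N \<Longrightarrow> 32 * (7/8 :: real) ^ n < 1/2"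
    by (auto simp: eventually_sequentially)
  have large: "1/2 * profile_mean 3 n \<le> profile_var 3 n" if "n \<ge> N" for n
  proof -
    have "depth_prob n 3 \<le> 4 * (7/8) ^ n"
      using depth_prob_le_stay_power[of n 3] by (simp add: power_one_over)
    then have "profile_mean 3 n \<le> 1/2"
      using N[OF that] by (simp add: profile_mean_eq)
    then have "profile_mean 3 n * (1/2) \<le> profile_mean 3 n * (1 - profile_mean 3 n)"
      using profile_mean_nonneg by (intro mult_left_mono) auto
    then show ?thesis
      using profile_var_ge[of 3 n] by simp
  qed
  have small: "\<exists>c>0. \<forall>n<M. c * profile_mean 3 n \<le> profile_var 3 n" for M
  proof (induction M)
    case 0
    show ?case by (intro exI[of _ 1]) simp
  next
    case (Suc M)
    then obtain c where c: "c > 0" "\<And>n. n < M \<Longrightarrow> c * profile_mean 3 n \<le> profile_var 3 n"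
      by blast
    have "\<exists>d>0. d * profile_mean 3 M \<le> profile_var 3 M"
    proof (cases "M \<ge> 3")
      case True
      \<comment> \<open>the summand 1 avoids a division by zero\<close>
      define d where "d = profile_var 3 M / (1 + profile_mean 3 M)"
      have "d > 0" "d * (1 + profile_mean 3 M) = profile_var 3 M"
        using profile_var_3_pos[OF True] profile_mean_nonneg[of 3 M] by (auto simp: d_def)
      then show ?thesis
        by (intro exI[of _ d]) (auto simp: algebra_simps)
    next
      case False
      then have "M = 0 \<or> M = 1 \<or> M = 2" by auto
      then have "profile_mean 3 M = 0"
        by (auto simp: profile_mean_eq numeral_eq_Suc)
      then show ?thesis
        using profile_var_nonneg[of 3 M] by (intro exI[of _ 1]) simp
    qed
    then obtain d where d: "d > 0" "d * profile_mean 3 M \<le> profile_var 3 M"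
      by blast
    have "min c d * profile_mean 3 n \<le> profile_var 3 n" if "n < Suc M" for n
    proof (cases "n = M")
      case True
      have "min c d * profile_mean 3 M \<le> d * profile_mean 3 M"
        using profile_mean_nonneg by (intro mult_right_mono) auto
      with d True show ?thesis by simp
    next
      case False
      have "min c d * profile_mean 3 n \<le> c * profile_mean 3 n"
        using profile_mean_nonneg by (intro mult_right_mono) auto
      with c(2)[of n] False that show ?thesis by simp
    qed
    then show ?case
      using c(1) d(1) by (intro exI[of _ "min c d"]) auto
  qed
  obtain c where c: "c > 0" "\<And>n. n < N \<Longrightarrow> c * profile_mean 3 n \<le> profile_var 3 n"
    using small by blast
  have "min c (1/2) * profile_mean 3 n \<le> profile_var 3 n" for n
  proof -
    have "min c (1/2) * profile_mean 3 n \<le> (if n < N then c else 1/2) * profile_mean 3 n"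
      using profile_mean_nonneg by (intro mult_right_mono) auto
    also have "\<dots> \<le> profile_var 3 n"
      using c(2) large by auto
    finally show ?thesis .
  qed
  then show ?thesis
    using c(1) by (intro exI[of _ "min c (1/2)"]) auto
qed

text \<open>
  The variance satisfies with \<open>\<ge>\<close> the linear recursion that the mean satisfies with equality.
\<close>

lemma profile_var_ge_mean: "\<exists>c>0. \<forall>k n. k \<ge> 3 \<longrightarrow> c * profile_mean k n \<le> profile_var k n"
proof -
  obtain c where c: "c > 0" "\<And>n. c * profile_mean 3 n \<le> profile_var 3 n"
    using profile_var_3_ge by blast
  have "c * profile_mean k n \<le> profile_var k n" if "k \<ge> 3" for k n
    using that
  proof (induction k arbitrary: n rule: dec_induct)
    case (step k)
    show ?case
    proof (cases n)
      case 0
      then show ?thesis using profile_var_nonneg by simp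
    next
      case (Suc m)
      have "c * profile_mean (Suc k) (Suc m) = 2 * binomial_mean m (\<lambda>j. c * profile_mean k j)"
        unfolding profile_mean_Suc binomial_mean_linear by simp
      also have "\<dots> \<le> 2 * binomial_mean m (profile_var k)"
        using binomial_mean_mono[of m "\<lambda>j. c * profile_mean k j" "profile_var k"] step.IH by simp
      also have "\<dots> \<le> profile_var (Suc k) (Suc m)"
        by (rule profile_var_Suc_ge)
      finally show ?thesis by (simp add: Suc)
    qed
  qed (rule c(2))
  with c(1) show ?thesis by blast
qed

section \<open>The lower edge of the window\<close>

definition lower_edge :: "real \<Rightarrow> nat \<Rightarrow> real" where
  "lower_edge C n = k_s n + C / ln (real n)"

text \<open>
  In terms of \<open>x = ln n\<close>, the power \<open>2 powr lower_edge C n\<close> is \<open>n / x\<close> up to the factor \<open>exp y\<close>, where \<open>y\<close>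
  tends to 0.
\<close>

lemma powr_lower_edge:
  fixes C :: real and n :: nat
  defines "x \<equiv> ln (real n)"
  defines "y \<equiv> (ln x + C * ln 2) / x"
  assumes n: "n \<ge> 3"
  shows "2 powr lower_edge C n = exp (x - ln x + y)" "real n * 2 powr - lower_edge C n = x * exp (- y)"
proof -
  have x: "x > 0" using n by (simp add: x_def)
  have "lower_edge C n * ln 2 = x - ln x + y"
    unfolding lower_edge_def k_s_def x_def[symmetric] y_def log_def using x
    by (simp add: x_def[symmetric] field_simps)
  then have e: "exp (lower_edge C n * ln 2) = exp (x - ln x + y)" "exp (- lower_edge C n * ln 2) = exp (- (x - ln x + y))"
    by simp_all
  show "2 powr lower_edge C n = exp (x - ln x + y)"
    using e(1) by (simp add: powr_def)
  have "real n = exp x" using n by (simp add: x_def)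
  then have "real n * 2 powr - lower_edge C n = exp (x + - (x - ln x + y))"
    unfolding exp_add using e(2) by (simp add: powr_def)
  also have "\<dots> = x * exp (- y)"
    using x by (simp add: exp_diff exp_minus field_simps)
  finally show "real n * 2 powr - lower_edge C n = x * exp (- y)" .
qed

text \<open>
  The exponent is \<open>x - ln x + y - x * exp (- y)\<close> with \<open>y = (ln x + C * ln 2) / x\<close>, and
  \<open>x * exp (- y) = x - ln x - C * ln 2 + o(1)\<close>. The quadratic term with coefficient \<open>q\<close> vanishes in
  the limit; it is carried along because the lower bound \<open>1 - p \<ge> exp (- p - 2 * p\<^sup>2)\<close> produces it.
\<close>

lemma lower_edge_limit:
  fixes C q :: real
  shows "(\<lambda>n. 2 powr lower_edge C n * exp (- (real n * (2 powr - lower_edge C n + q * (2 powr - lower_edge C n)\<^sup>2))))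
    \<longlonglongrightarrow> 2 powr C"
proof -
  define K where "K = C * ln 2"
  define y where "y = (\<lambda>x. (ln x + K) / x)"
  define g where "g = (\<lambda>x. exp (x - ln x + y x - x * exp (- y x) - q * (x * exp (- y x)) * exp (- (x - ln x + y x))))"
  have "((\<lambda>x. x - ln x + (ln x + K) / x - x * exp (- ((ln x + K) / x))) \<longlongrightarrow> K) at_top"
    by real_asymp
  moreover have "((\<lambda>x. (x * exp (- ((ln x + K) / x))) * exp (- (x - ln x + (ln x + K) / x))) \<longlongrightarrow> 0) at_top"
    by real_asymp
  ultimately have "(g \<longlongrightarrow> exp (K - q * 0)) at_top"
    unfolding g_def y_def by (auto intro!: tendsto_exp tendsto_diff tendsto_mult_left simp only: mult.assoc)
  then have "((\<lambda>n. g (ln (real n))) \<longlongrightarrow> exp (K - q * 0)) sequentially"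
    by (rule filterlim_compose) real_asymp
  moreover have "\<forall>\<^sub>F n in sequentially. g (ln (real n)) =
      2 powr lower_edge C n * exp (- (real n * (2 powr - lower_edge C n + q * (2 powr - lower_edge C n)\<^sup>2)))"
    using eventually_ge_at_top[of 3]
  proof eventually_elim
    case (elim n)
    define x where "x = ln (real n)"
    define p where "p = 2 powr - lower_edge C n"
    have 1: "2 powr lower_edge C n = exp (x - ln x + y x)" and 2: "real n * p = x * exp (- y x)"
      using powr_lower_edge[OF elim, of C] by (simp_all add: x_def y_def K_def p_def)
    have 3: "p = exp (- (x - ln x + y x))"
      unfolding p_def powr_minus 1 by (simp only: exp_minus)
    have "real n * (p + q * p\<^sup>2) = (real n * p) + q * (real n * p) * p"
      by (simp add: power2_eq_square algebra_simps)
    also have "\<dots> = x * exp (- y x) + q * (x * exp (- y x)) * exp (- (x - ln x + y x))"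
      unfolding 2 by (simp only: 3)
    finally show ?case
      unfolding p_def[symmetric] 1 x_def[symmetric] g_def by (simp add: exp_add[symmetric])
  qed
  ultimately have "((\<lambda>n. 2 powr lower_edge C n * exp (- (real n * (2 powr - lower_edge C n + q * (2 powr - lower_edge C n)\<^sup>2))))
      \<longlongrightarrow> exp (K - q * 0)) sequentially"
    by (rule Lim_transform_eventually)
  then show ?thesis
    by (simp add: K_def powr_def)
qed

text \<open>
  The bound \<open>4 * 2 ^ k * exp (- n / 2 ^ k)\<close> increases with \<open>k\<close>, so it suffices to evaluate it at the edge.
\<close>

lemma mean_bounded_below_lower_edge:
  "\<forall>\<^sub>F n in sequentially. \<forall>k. real k \<le> lower_edge C n \<longrightarrow> profile_mean k n \<le> 8 * 2 powr C"
proof -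
  have "\<forall>\<^sub>F n in sequentially. 2 powr lower_edge C n * exp (- (real n * 2 powr - lower_edge C n)) < 2 * 2 powr C"
    using order_tendstoD(2)[OF lower_edge_limit[of C 0], of "2 * 2 powr C"] by simp
  then show ?thesis
  proof eventually_elim
    case (elim n)
    show ?case
    proof (intro allI impI)
      fix k assume k: "real k \<le> lower_edge C n"
      have "stay k ^ n \<le> exp (- ((1/2) ^ k)) ^ n"
        by (intro power_mono stay_le_exp stay_nonneg)
      also have "\<dots> = exp (- (real n * (1/2) ^ k))"
        by (simp flip: exp_of_nat_mult)
      also have "\<dots> = exp (- (real n * 2 powr - real k))"
        by (simp add: powr_minus powr_realpow power_one_over inverse_eq_divide)
      also have "\<dots> \<le> exp (- (real n * 2 powr - lower_edge C n))"
        using k by (simp add: mult_left_mono)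
      finally have "depth_prob n k \<le> 4 * exp (- (real n * 2 powr - lower_edge C n))"
        using depth_prob_le_stay_power[of n k] by linarith
      moreover have "(2::real) ^ k \<le> 2 powr lower_edge C n"
        using k by (simp flip: powr_realpow)
      ultimately have "2 ^ k * depth_prob n k \<le> 2 powr lower_edge C n * (4 * exp (- (real n * 2 powr - lower_edge C n)))"
        using depth_prob_nonneg by (intro mult_mono) auto
      also have "\<dots> \<le> 8 * 2 powr C"
        using elim by simp
      finally show "profile_mean k n \<le> 8 * 2 powr C"
        by (simp add: profile_mean_eq)
    qed
  qed
qed

lemma mean_large_above_lower_edge:
  "\<forall>\<^sub>F n in sequentially. \<forall>k. lower_edge C n \<le> real k \<and> 2 * 2 ^ k \<le> n \<longrightarrow> 2 powr C / 4 \<le> profile_mean k n"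
proof -
  have "\<forall>\<^sub>F n in sequentially. 1/2 * 2 powr C <
      2 powr lower_edge C n * exp (- (real n * (2 powr - lower_edge C n + 2 * (2 powr - lower_edge C n)\<^sup>2)))"
    by (rule order_tendstoD(1)[OF lower_edge_limit[of C 2]]) simp
  moreover have "\<forall>\<^sub>F n in sequentially. lower_edge C n \<ge> 1"
    unfolding lower_edge_def k_s_def by real_asymp
  ultimately show ?thesis
  proof eventually_elim
    case (elim n)
    show ?case
    proof (intro allI impI)
      fix k assume "lower_edge C n \<le> real k \<and> 2 * 2 ^ k \<le> n"
      then have k: "lower_edge C n \<le> real k" "2 * 2 ^ k \<le> n" by auto
      have "k \<ge> 1" using k(1) elim(2) by linarith
      define p where "p = 2 powr - lower_edge C n"
      define x :: real where "x = (1/2) ^ k"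
      have "x = 2 powr - real k"
        by (simp add: x_def powr_minus powr_realpow power_one_over inverse_eq_divide)
      then have x: "0 \<le> x" "x \<le> p"
        using k(1) by (auto simp: p_def)
      have "exp (- (real n * (p + 2 * p\<^sup>2))) \<le> exp (- (real n * (x + 2 * x\<^sup>2)))"
        unfolding exp_le_cancel_iff neg_le_iff_le using x by (intro mult_left_mono add_mono power_mono) auto
      also have "\<dots> = exp (- x - 2 * x\<^sup>2) ^ n"
        by (subst exp_of_nat_mult[symmetric]) (simp add: algebra_simps)
      also have "\<dots> \<le> stay k ^ n"
        unfolding x_def using half_power_le_half[OF \<open>k \<ge> 1\<close>] by (intro power_mono exp_le_one_minus) auto
      finally have "exp (- (real n * (p + 2 * p\<^sup>2))) / 2 \<le> depth_prob n k"
        using stay_power_half_le_depth_prob[OF k(2)] by linarith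
      moreover have "2 powr lower_edge C n \<le> (2::real) ^ k"
        using k by (simp flip: powr_realpow)
      ultimately have "2 powr lower_edge C n * (exp (- (real n * (p + 2 * p\<^sup>2))) / 2) \<le> 2 ^ k * depth_prob n k"
        by (intro mult_mono) auto
      then show "2 powr C / 4 \<le> profile_mean k n"
        using elim(1) by (simp add: profile_mean_eq p_def)
    qed
  qed
qed

section \<open>Probabilities of reaching large depths\<close>

text \<open>
  Union bound over the times of the last \<open>m\<close> jumps, which leave the states \<open>a, \<dots>, a + m - 1\<close>.
\<close>

lemma depth_prob_le_choose:
  "depth_prob n (a + m) \<le> real (n choose m) * (\<Prod>i\<in>{a..<a + m}. (1/2) ^ i)"
proof (induction n arbitrary: m)
  case 0
  then show ?case
    by (cases m) (auto simp: depth_prob_le_1)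
next
  case (Suc n)
  show ?case
  proof (cases m)
    case 0
    then show ?thesis using depth_prob_le_1 by simp
  next
    case (Suc l)
    define P where "P = (\<lambda>l. \<Prod>i\<in>{a..<a + l}. (1/2 :: real) ^ i)"
    have "depth_prob (Suc n) (a + m) = stay (a + m) * depth_prob n (a + m) + (1/2) ^ (a + l) * depth_prob n (a + l)"
      by (simp add: Suc)
    also have "\<dots> \<le> 1 * depth_prob n (a + m) + (1/2) ^ (a + l) * depth_prob n (a + l)"
      using depth_prob_nonneg by (intro add_mono mult_right_mono) auto
    also have "\<dots> \<le> 1 * (real (n choose m) * P m) + (1/2) ^ (a + l) * (real (n choose l) * P l)"
      unfolding P_def by (intro add_mono mult_left_mono Suc.IH) auto
    also have "(1/2) ^ (a + l) * (real (n choose l) * P l) = real (n choose l) * P m"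
      by (simp add: P_def Suc)
    finally show ?thesis
      by (simp add: P_def Suc algebra_simps)
  qed
qed

text \<open>
  Convexity of the exponential function, with the weights not normalised.
\<close>

lemma weighted_exp_ge:
  fixes x y t :: real
  assumes "p * x + q * y = (p + q) * t" "p \<ge> 0" "q \<ge> 0"
  shows "(p + q) * exp t \<le> p * exp x + q * exp y"
proof -
  have tangent: "exp t * (1 + (z - t)) \<le> exp z" for z
    using exp_ge_add_one_self[of "z - t"] by (simp add: exp_diff field_simps)
  have "p * (exp t * (1 + (x - t))) \<le> p * exp x" "q * (exp t * (1 + (y - t))) \<le> q * exp y"
    using assms(2,3) tangent by (auto intro!: mult_left_mono)
  moreover have "p * (exp t * (1 + (x - t))) + q * (exp t * (1 + (y - t)))
      = exp t * (p * x + q * y + (p + q) - (p + q) * t)"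
    by (simp add: algebra_simps)
  ultimately show ?thesis
    unfolding assms(1) by (simp add: mult_ac)
qed

text \<open>
  Start from state \<open>a\<close> at time \<open>n0\<close> and make \<open>m\<close> jumps and \<open>d\<close> pauses in the next \<open>d + m\<close> steps. There are
  \<open>(d + m) choose m\<close> schedules; each has the same product of jump probabilities, and a pause in state \<open>i\<close>
  contributes a factor \<open>stay i\<close>. Averaged over all schedules each of the \<open>m + 1\<close> states receives
  \<open>d / (m + 1)\<close> pauses, so by the inequality of arithmetic and geometric means the sum over the schedules is at
  least the number of schedules times the product of the \<open>stay i\<close> to the power \<open>d / (m + 1)\<close>. The
  induction proves this inequality directly: the last step is a pause for a proportion
  \<open>d / (d + m)\<close> of the schedules, and the two exponents average to the required one.
\<close>

lemma depth_prob_ge_choose: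
  assumes "a \<ge> 1"
  shows "depth_prob n0 a * (\<Prod>i\<in>{a..<a + m}. (1/2) ^ i) * real ((d + m) choose m)
           * exp (real d / real (m + 1) * (\<Sum>i\<in>{a..a + m}. ln (stay i)))
         \<le> depth_prob (n0 + d + m) (a + m)"
proof (induction "d + m" arbitrary: d m rule: less_induct)
  case less
  define P where "P = (\<lambda>m. \<Prod>i\<in>{a..<a + m}. (1/2 :: real) ^ i)"
  define W where "W = (\<lambda>m. \<Sum>i\<in>{a..a + m}. ln (stay i))"
  define A where "A = depth_prob n0 a"
  define B where "B = (\<lambda>d m. A * P m * real ((d + m) choose m) * exp (real d / real (m + 1) * W m))"
  have A: "A \<ge> 0" and P: "P i \<ge> 0" for i
    by (auto simp: A_def depth_prob_nonneg P_def intro!: prod_nonneg)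
  have IH: "B d' m' \<le> depth_prob (n0 + d' + m') (a + m')" if "d' + m' < d + m" for d' m'
    using less[OF that] by (simp only: A_def B_def P_def W_def)
  have pos: "stay i > 0" if "i \<ge> a" for i
    using stay_ge_half[of i] that assms by simp
  have exp_stay: "exp (ln (stay i)) = stay i" if "i \<ge> a" for i
    using pos[OF that] by simp
  have "B d m \<le> depth_prob (n0 + d + m) (a + m)"
  proof (cases d)
    case d: 0
    show ?thesis
    proof (cases m)
      case 0
      then show ?thesis using d by (simp add: B_def A_def P_def)
    next
      case (Suc l)
      have "B d m = (1/2) ^ (a + l) * B 0 l"
        by (simp add: B_def d Suc P_def mult_ac)
      also have "\<dots> \<le> (1/2) ^ (a + l) * depth_prob (n0 + 0 + l) (a + l)"
        by (intro mult_left_mono IH) (auto simp: d Suc)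
      also have "\<dots> \<le> depth_prob (n0 + d + m) (a + m)"
        using stay_nonneg[of "a + m"] depth_prob_nonneg[of "n0 + l" "a + m"] by (simp add: d Suc)
      finally show ?thesis .
    qed
  next
    case d: (Suc e)
    show ?thesis
    proof (cases m)
      case 0
      have "B d m = stay a * B e 0"
        using exp_stay[of a] by (simp add: B_def d 0 P_def W_def exp_add ring_distribs)
      also have "\<dots> \<le> stay a * depth_prob (n0 + e + 0) (a + 0)"
        by (intro mult_left_mono IH stay_nonneg) (auto simp: d 0)
      also have "\<dots> \<le> depth_prob (n0 + d + m) (a + m)"
        using assms depth_prob_nonneg by (cases a) (auto simp: d 0)
      finally show ?thesis .
    next
      case m: (Suc l)
      define u where "u = ln (stay (a + m))"
      define x where "x = u + real e / real (m + 1) * W m"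
      define y where "y = real d / real m * (W m - u)"
      define c where "c = real ((d + m) choose m)"
      have W: "W l = W m - u"
        by (simp add: W_def u_def m)
      have c1: "real ((e + m) choose m) = c * (real d / real (d + m))"
      proof -
        have "(d + m) * ((e + m) choose e) = d * ((d + m) choose d)"
          using Suc_times_binomial_eq[of "e + m" e] by (simp add: d)
        then have "(d + m) * ((e + m) choose m) = d * ((d + m) choose m)"
          using binomial_symmetric[of e "e + m"] binomial_symmetric[of d "d + m"] by simp
        then have "real (d + m) * real ((e + m) choose m) = real d * c"
          unfolding c_def by (simp only: of_nat_mult[symmetric])
        then show ?thesis by (simp add: field_simps d)
      qed
      have c2: "real ((d + l) choose l) = c * (real m / real (d + m))"
      proof -
        have "(d + m) * ((d + l) choose l) = m * ((d + m) choose m)"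
          using Suc_times_binomial_eq[of "d + l" l] by (simp add: m)
        then have "real (d + m) * real ((d + l) choose l) = real m * c"
          unfolding c_def by (simp only: of_nat_mult[symmetric])
        then show ?thesis by (simp add: field_simps d)
      qed
      have "(real d + real m) * exp (real d / real (m + 1) * W m) \<le> real d * exp x + real m * exp y"
      proof (rule weighted_exp_ge)
        define M where "M = real (m + 1)"
        have M: "M > 0" "real d + real m = real e + M"
          by (auto simp: M_def d)
        have "real m * y = real d * (W m - u)"
          by (simp add: y_def m)
        then have "real d * x + real m * y = real d * (u + real e / M * W m) + real d * (W m - u)"
          by (simp add: x_def M_def)
        also have "\<dots> = (real e + M) * (real d / M * W m)"
          using M(1) by (simp add: field_simps)
        finally show "real d * x + real m * y = (real d + real m) * (real d / real (m + 1) * W m)"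
          by (simp only: M(2) M_def)
      qed auto
      then have "exp (real d / real (m + 1) * W m) \<le> (real d * exp x + real m * exp y) / real (d + m)"
        by (subst pos_le_divide_eq) (auto simp only: of_nat_add mult.commute d of_nat_0_less_iff)
      then have "exp (real d / real (m + 1) * W m) \<le> real d / real (d + m) * exp x + real m / real (d + m) * exp y"
        by (simp only: add_divide_distrib times_divide_eq_left)
      then have "B d m \<le> A * P m * c * (real d / real (d + m) * exp x + real m / real (d + m) * exp y)"
        unfolding B_def c_def[symmetric] using A P by (intro mult_left_mono) (auto simp: c_def)
      also have "\<dots> = stay (a + m) * B e m + (1/2) ^ (a + l) * B d l"
      proof -
        have "B e m * stay (a + m) = A * P m * c * (real d / real (d + m)) * exp x"
          unfolding B_def c1 x_def exp_add u_def using exp_stay[of "a + m"] by (simp add: mult_ac)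
        moreover have "(1/2) ^ (a + l) * B d l = A * P m * c * (real m / real (d + m)) * exp y"
          unfolding B_def c2 y_def W by (simp add: m P_def mult_ac)
        ultimately show ?thesis by (simp add: ring_distribs mult_ac)
      qed
      also have "\<dots> \<le> stay (a + m) * depth_prob (n0 + e + m) (a + m)
          + (1/2) ^ (a + l) * depth_prob (n0 + d + l) (a + l)"
        by (intro add_mono mult_left_mono IH stay_nonneg) (auto simp: d m)
      also have "\<dots> = depth_prob (n0 + d + m) (a + m)"
        by (simp add: d m)
      finally show ?thesis .
    qed
  qed
  then show ?case
    by (simp only: A_def B_def P_def W_def)
qed

lemma power_le_fact_mult_choose: "d ^ m \<le> fact m * ((d + m) choose m)"
proof (induction m)
  case (Suc m)
  have "d ^ Suc m \<le> (d + Suc m) * (fact m * ((d + m) choose m))"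
    using mult_mono[OF _ Suc, of d "d + Suc m"] by simp
  also have "\<dots> = fact m * (Suc (d + m) * ((d + m) choose m))"
    by (simp add: algebra_simps)
  also have "\<dots> = fact (Suc m) * ((d + Suc m) choose Suc m)"
    unfolding Suc_times_binomial_eq by (simp only: fact_Suc of_nat_id add_Suc_right mult_ac)
  finally show ?case .
qed simp

lemma exp_double_le_one_minus:
  fixes x :: real
  assumes "0 \<le> x" "x \<le> 1/2"
  shows "exp (- 2 * x) \<le> 1 - x"
proof -
  have "x\<^sup>2 \<le> x * (1/2)"
    unfolding power2_eq_square using assms by (intro mult_left_mono)
  then have "exp (- 2 * x) \<le> exp (- x - 2 * x\<^sup>2)"
    by simp
  with exp_le_one_minus[OF assms] show ?thesis by linarith
qed

text \<open>
  Use the time \<open>n0 = 2 ^ (a + 1)\<close>, at most a fraction \<open>1 / (2 * m)\<close> of the total, to reach the state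
  \<open>a\<close>, which succeeds with probability bounded below. Shortening the remaining time by this fraction costs a
  constant factor in \<open>n ^ m\<close>. The pauses cost a constant factor too, as there are on average
  \<open>n / m\<close> of them per state, which is at most \<open>8 * 2 ^ a\<close>, while the jump probabilities from \<open>a\<close> on sum
  to at most \<open>2 * 2 ^ -a\<close>.
\<close>

lemma depth_prob_ge_power:
  assumes m: "m \<ge> 2" "2 * m\<^sup>2 \<le> n" and a: "a \<ge> 1" and n: "4 * m * 2 ^ a \<le> n" "n \<le> 8 * m * 2 ^ a"
  shows "exp (-38) / 2 * (real n ^ m / fact m * (\<Prod>i\<in>{a..<a + m}. (1/2) ^ i)) \<le> depth_prob n (a + m)"
proof -
  define n0 :: nat where "n0 = 2 * 2 ^ a"
  define d where "d = n - n0 - m"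
  define P where "P = (\<Prod>i\<in>{a..<a + m}. (1/2 :: real) ^ i)"
  have P: "P \<ge> 0"
    by (auto simp: P_def intro!: prod_nonneg)
  have n0: "2 * m * n0 \<le> n"
    using n(1) by (simp add: n0_def mult_ac)
  have "2 * m * (n0 + m) \<le> n + n"
    using n0 m(2) by (simp add: power2_eq_square algebra_simps)
  then have mn: "m * (n0 + m) \<le> n" by simp
  have "1 * (n0 + m) \<le> m * (n0 + m)"
    using m(1) by (intro mult_right_mono) auto
  from order.trans[OF this mn] have d: "n = n0 + d + m"
    by (simp add: d_def)
  have d_ge: "real d \<ge> real n * (1 - 1 / real m)"
  proof -
    have "real m * (real n0 + real m) \<le> real n"
      using mn by (metis of_nat_add of_nat_le_iff of_nat_mult)
    then have "real n0 + real m \<le> real n / real m"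
      using m(1) by (simp add: field_simps)
    moreover have "real d = real n - (real n0 + real m)"
      using d by simp
    ultimately show ?thesis
      by (simp add: right_diff_distrib)
  qed
  have start: "depth_prob n0 a \<ge> exp (-4) / 2"
  proof -
    have "exp (- 2 * (1/2) ^ a) ^ n0 \<le> stay a ^ n0"
      using half_power_le_half[OF a] by (intro power_mono exp_double_le_one_minus) auto
    also have "exp (- 2 * (1/2) ^ a :: real) ^ n0 = exp (-4)"
      by (simp add: n0_def power_divide flip: exp_of_nat_mult)
    finally show ?thesis
      using stay_power_half_le_depth_prob[of a n0] by (simp add: n0_def)
  qed
  have choose: "real ((d + m) choose m) \<ge> exp (-2) * (real n ^ m / fact m)"
  proof -
    have "exp (-2) = exp (- 2 * (1 / real m)) ^ m"
      using m(1) by (simp flip: exp_of_nat_mult)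
    also have "\<dots> \<le> (1 - 1 / real m) ^ m"
      using m(1) by (intro power_mono exp_double_le_one_minus) (auto simp: field_simps)
    finally have "exp (-2) * real n ^ m \<le> (1 - 1 / real m) ^ m * real n ^ m"
      by (intro mult_right_mono) auto
    also have "\<dots> = (real n * (1 - 1 / real m)) ^ m"
      by (simp add: power_mult_distrib)
    also have "\<dots> \<le> real d ^ m"
      using d_ge m(1) by (intro power_mono) auto
    also have "\<dots> \<le> fact m * real ((d + m) choose m)"
      using of_nat_mono[OF power_le_fact_mult_choose[of d m], where 'a = real] by simp
    finally show ?thesis
      by (simp add: field_simps)
  qed
  have stay_prod: "exp (-32) \<le> exp (real d / real (m + 1) * (\<Sum>i\<in>{a..a + m}. ln (stay i)))"
  proof -
    have "(\<Sum>i\<in>{a..a + m}. (1/2 :: real) ^ i) \<le> 2 * (1/2) ^ a"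
    proof -
      have "(\<Sum>i\<in>{a..a + m}. (1/2 :: real) ^ i) = 2 * (1/2) ^ a - (1/2) ^ (a + m)"
        by (induction m) auto
      then show ?thesis by simp
    qed
    moreover have "(\<Sum>i\<in>{a..a + m}. - 2 * (1/2) ^ i) \<le> (\<Sum>i\<in>{a..a + m}. ln (stay i))"
    proof (rule sum_mono)
      fix i assume "i \<in> {a..a + m}"
      then have i: "i \<ge> 1" using a by simp
      show "- 2 * (1/2) ^ i \<le> ln (stay i)"
        using exp_double_le_one_minus[of "(1/2) ^ i"] half_power_le_half[OF i] stay_ge_half[OF i]
        by (subst ln_ge_iff) auto
    qed
    ultimately have S: "(\<Sum>i\<in>{a..a + m}. ln (stay i)) \<ge> - 4 * (1/2) ^ a"
      by (simp add: sum_negf flip: sum_distrib_left)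
    have "real d / real (m + 1) \<le> real n / real m"
      using m(1) d by (intro frac_le) auto
    also have "\<dots> \<le> 8 * 2 ^ a"
    proof -
      have "real n \<le> real (8 * m * 2 ^ a)"
        using n(2) by (rule of_nat_mono)
      then show ?thesis
        using m(1) by (simp add: field_simps)
    qed
    finally have "real d / real (m + 1) * (4 * (1/2) ^ a) \<le> 8 * 2 ^ a * (4 * (1/2) ^ a)"
      by (rule mult_right_mono) simp
    also have "\<dots> = 32"
      by (simp add: power_divide)
    finally have "- 32 \<le> real d / real (m + 1) * (- 4 * (1/2) ^ a)"
      by simp
    also have "\<dots> \<le> real d / real (m + 1) * (\<Sum>i\<in>{a..a + m}. ln (stay i))"
      using S by (intro mult_left_mono) auto
    finally show ?thesis by simp
  qed
  have "exp (-4) / 2 * P * (exp (-2) * (real n ^ m / fact m)) * exp (-32)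
      \<le> depth_prob n0 a * P * real ((d + m) choose m)
          * exp (real d / real (m + 1) * (\<Sum>i\<in>{a..a + m}. ln (stay i)))"
    using P depth_prob_nonneg
    by (intro mult_mono start choose stay_prod order_refl) (auto intro!: mult_nonneg_nonneg)
  also have "\<dots> \<le> depth_prob n (a + m)"
    unfolding P_def using depth_prob_ge_choose[OF a] by (simp only: d)
  also have "exp (-4) / 2 * P * (exp (-2) * (real n ^ m / fact m)) * exp (-32)
      = exp (-4) * exp (-2) * exp (-32) / 2 * (real n ^ m / fact m * P)"
    by (simp only: mult_ac times_divide_eq_right times_divide_eq_left divide_divide_eq_left)
  also have "exp (-4) * exp (-2) * exp (-32) = exp (-38 :: real)"
    by (simp flip: exp_add)
  finally show ?thesis
    by (simp only: P_def)
qed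

section \<open>The saddle point at the upper edge\<close>

text \<open>
  The logarithm of Stirling's approximation to the factorial, without the constant.
\<close>

definition log_stirling :: "real \<Rightarrow> real" where
  "log_stirling x = x * ln x - x + ln x / 2"

text \<open>
  Trapezoidal and midpoint rule for the integral of \<open>1 / x\<close> over \<open>[m, m + 1]\<close>.
\<close>

lemma ln_fact_minus_log_stirling_step:
  assumes m: "m \<ge> 1"
  defines "E \<equiv> \<lambda>m. ln (fact m :: real) - log_stirling (real m)"
  shows "E (Suc m) \<le> E m" "E m - 1 / (4 * real m * (real m + 1)) \<le> E (Suc m)"
proof -
  define x where "x = real m"
  have x: "x > 0" using m by (simp add: x_def)
  define D where "D = (x + 1/2) * (ln (x + 1) - ln x)"
  have "ln (fact (Suc m) :: real) = ln (x + 1) + ln (fact m)"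
    by (simp add: ln_mult x_def add.commute)
  then have E: "E (Suc m) = E m + 1 - D"
    by (simp add: E_def log_stirling_def D_def x_def[symmetric] algebra_simps add_divide_distrib)
  have "2 * (x + 1 - x) / (x + (x + 1)) \<le> ln (x + 1) - ln x"
    using x by (intro ln_inverse_approx_ge) auto
  then have "(x + 1/2) * (2 / (2 * x + 1)) \<le> D"
    unfolding D_def using x by (intro mult_left_mono) auto
  also have "(x + 1/2) * (2 / (2 * x + 1)) = 1"
    using x by (simp add: field_simps)
  finally show "E (Suc m) \<le> E m"
    using E by simp
  have "D \<le> (x + 1/2) * (1 * (inverse x + inverse (x + 1)) / 2)"
    unfolding D_def using x by (intro mult_left_mono ln_inverse_approx_le) auto
  also have "inverse x + inverse (x + 1) = (2 * x + 1) / (x * (x + 1))"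
    using x by (simp add: divide_simps)
  also have "(x + 1/2) * (1 * ((2 * x + 1) / (x * (x + 1))) / 2) = (4 * x * (x + 1) + 1) / (4 * x * (x + 1))"
    by (simp add: divide_simps) (simp add: algebra_simps)
  also have "\<dots> = 1 + 1 / (4 * x * (x + 1))"
    using x by (subst add_divide_distrib) simp
  finally show "E m - 1 / (4 * real m * (real m + 1)) \<le> E (Suc m)"
    using E by (simp add: x_def)
qed

lemma ln_fact_bounds:
  assumes "m \<ge> 1"
  shows "3/4 \<le> ln (fact m :: real) - log_stirling (real m)"
    and "ln (fact m :: real) - log_stirling (real m) \<le> 1"
proof -
  define E where "E = (\<lambda>m. ln (fact m :: real) - log_stirling (real m))"
  have "3/4 + 1 / (4 * real m) \<le> E m \<and> E m \<le> 1"
    using assms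
  proof (induction m rule: dec_induct)
    case base
    show ?case by (simp add: E_def log_stirling_def)
  next
    case (step m)
    define x where "x = real m"
    have x: "x > 0" using step(1) by (simp add: x_def)
    have "3/4 + 1 / (4 * real (Suc m)) = 3/4 + 1 / (4 * x) - 1 / (4 * x * (x + 1))"
    proof -
      have "1 / (4 * x) = (x + 1) / (4 * x * (x + 1))" "1 / (4 * (x + 1)) = x / (4 * x * (x + 1))"
        using x by simp_all
      moreover have "x / (4 * x * (x + 1)) = (x + 1) / (4 * x * (x + 1)) - 1 / (4 * x * (x + 1))"
        unfolding diff_divide_distrib[symmetric] by (simp only: add_diff_cancel_right')
      moreover have "real (Suc m) = x + 1"
        by (simp add: x_def)
      ultimately show ?thesis
        by (simp only: add_diff_eq)
    qed
    also have "\<dots> \<le> E m - 1 / (4 * x * (x + 1))"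
      using step.IH by (intro diff_right_mono) (simp add: x_def)
    also have "\<dots> \<le> E (Suc m)"
      using ln_fact_minus_log_stirling_step(2)[OF step(1)] by (simp only: E_def x_def)
    finally have "3/4 + 1 / (4 * real (Suc m)) \<le> E (Suc m)" .
    moreover have "E (Suc m) \<le> E m"
      using ln_fact_minus_log_stirling_step(1)[OF step(1)] by (simp only: E_def)
    ultimately show ?case
      using step.IH by simp
  qed
  moreover have "1 / (4 * real m) \<ge> 0" by simp
  ultimately have "3/4 \<le> E m" "E m \<le> 1"
    by linarith+
  then show "3/4 \<le> ln (fact m :: real) - log_stirling (real m)"
    "ln (fact m :: real) - log_stirling (real m) \<le> 1"
    by (simp_all only: E_def)
qed

text \<open>
  The left side is the logarithm of the bound \<open>jump_bound\<close> for \<open>m\<close> jumps at level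
  \<open>s\<^sup>2 / 2 + nu\<close>, where \<open>t = ln 2\<close> and \<open>s\<^sup>2 / 2 = log 2 n\<close>. The number \<open>nu\<close> is chosen such that all
  terms growing with \<open>s\<close> cancel: with \<open>u = m - s\<close> there remains a quadratic in \<open>u\<close>, the constant \<open>d\<close>
  that locates the edge, and small corrections.
\<close>

lemma saddle_identity:
  fixes s m t nu d e :: real
  assumes s: "s > 0" and m: "m > 0"
    and nu: "t * nu = t * s - ln s + 3/2 * t + 1 + e / s" and e: "e = d - 3/2 * ln s"
  shows "t * (s\<^sup>2 / 2 + nu * (1 - m) + m * (m + 1) / 2) - log_stirling m =
     t * ((m - s)\<^sup>2 / 2 - (m - s)) + 3/2 * t + 1 - d + (1 - (m - s)) * (e / s) - (m + 1/2) * ln (m / s)"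
proof -
  define f where "f = e / s"
  have f: "f * s = e" using s by (simp add: f_def)
  define u where "u = m - s"
  have ms: "m = s + u" by (simp add: u_def)
  have lnm: "ln (m / s) = ln m - ln s"
    using s m by (simp add: ln_div)
  have "t * (s\<^sup>2 / 2 + nu * (1 - m) + m * (m + 1) / 2) = t * s\<^sup>2 / 2 + (t * nu) * (1 - m) + t * (m * (m + 1) / 2)"
    by (simp add: algebra_simps)
  also have "\<dots> = t * (u\<^sup>2 / 2 - u) + 3/2 * t + 1 - f * s + f * (1 - u) + m * ln s - ln s - m"
    unfolding nu f_def[symmetric] ms by (simp add: field_simps power2_eq_square)
  finally have "t * (s\<^sup>2 / 2 + nu * (1 - m) + m * (m + 1) / 2) =
      t * (u\<^sup>2 / 2 - u) + 3/2 * t + 1 - f * s + f * (1 - u) + m * ln s - ln s - m" .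
  then show ?thesis
    unfolding f lnm f_def[symmetric] u_def[symmetric] log_stirling_def
    using e by (simp add: algebra_simps diff_divide_distrib)
qed

text \<open>
  The logarithm is estimated by \<open>ln (m / s) \<le> (m - s) / s\<close>, which is good enough for every \<open>m\<close>: the
  quadratic term in \<open>m - s\<close> dominates.
\<close>

lemma saddle_lower:
  fixes s m t nu d e :: real
  assumes "s \<ge> 100" "m > 0" "t * nu = t * s - ln s + 3/2 * t + 1 + e / s" "e = d - 3/2 * ln s"
    and e: "\<bar>e / s\<bar> \<le> 1/100" and t: "2/3 \<le> t" "t \<le> 1"
  shows "t * (s\<^sup>2 / 2 + nu * (1 - m) + m * (m + 1) / 2) - log_stirling m \<ge> - d - 5"
proof -
  define u where "u = m - s"
  have s: "s > 0" using assms(1) by simp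
  have "ln (m / s) \<le> u / s"
    using ln_le_minus_one[of "m / s"] s assms(2) by (simp add: u_def field_simps)
  then have "(m + 1/2) * ln (m / s) \<le> (m + 1/2) * (u / s)"
    using assms(2) by (intro mult_left_mono) auto
  also have "\<dots> = u + (u\<^sup>2 + u / 2) * (1 / s)"
    using s by (simp add: u_def field_simps power2_eq_square)
  also have "(u\<^sup>2 + u / 2) * (1 / s) \<le> (u\<^sup>2 + \<bar>u\<bar>) * (1 / 100)"
    using assms(1) by (intro mult_mono add_mono) (auto simp: field_simps)
  finally have 1: "(m + 1/2) * ln (m / s) \<le> u + (u\<^sup>2 + \<bar>u\<bar>) * (1 / 100)" by simp
  have "\<bar>(1 - u) * (e / s)\<bar> \<le> (1 + \<bar>u\<bar>) * (1/100)"
    unfolding abs_mult using e by (intro mult_mono) auto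
  then have 2: "(1 - u) * (e / s) \<ge> - ((1 + \<bar>u\<bar>) * (1/100))"
    by (rule abs_le_D2[THEN minus_le_iff[THEN iffD1]])
  have 3: "t * (u\<^sup>2 / 2 - u) \<ge> u\<^sup>2 / 3 - \<bar>u\<bar>"
  proof -
    have "t * u \<le> t * \<bar>u\<bar>"
      using t by (intro mult_left_mono) auto
    moreover have "t * \<bar>u\<bar> \<le> 1 * \<bar>u\<bar>"
      using t by (intro mult_right_mono) auto
    moreover have "2/3 * (u\<^sup>2 / 2) \<le> t * (u\<^sup>2 / 2)"
      using t by (intro mult_right_mono) auto
    ultimately show ?thesis by (simp add: algebra_simps)
  qed
  have "(\<bar>u\<bar> - 4)\<^sup>2 \<ge> 0" by simp
  then have 4: "u\<^sup>2 \<ge> 8 * \<bar>u\<bar> - 16"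
    by (simp add: power2_diff)
  have "t * (s\<^sup>2 / 2 + nu * (1 - m) + m * (m + 1) / 2) - log_stirling m =
     t * (u\<^sup>2 / 2 - u) + 3/2 * t + 1 - d + (1 - u) * (e / s) - (m + 1/2) * ln (m / s)"
    unfolding u_def by (rule saddle_identity) (use assms s in auto)
  moreover have "X + 3/2 * t + 1 - d + Y - Z \<ge> - d - 5"
    if "X \<ge> w / 3 - v" "Y \<ge> - ((1 + v) * (1/100))" "Z \<le> u + (w + v) * (1 / 100)"
      "w \<ge> 8 * v - 16" "u \<le> v" "0 \<le> v" for X Y Z v w
  proof -
    have "Y \<ge> - 1/100 - v / 100" "Z \<le> u + w / 100 + v / 100"
      using that(2,3) by (simp_all add: distrib_right add_divide_distrib)
    with that(1,4-6) t(1) show ?thesis by linarith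
  qed
  ultimately show ?thesis
    using 1 2 3 4 by simp
qed

lemma saddle_upper:
  fixes s m t nu d e :: real
  assumes s: "s > 0" and m: "s \<le> m" "m \<le> s + 1"
    and "t * nu = t * s - ln s + 3/2 * t + 1 + e / s" "e = d - 3/2 * ln s"
    and e: "\<bar>e / s\<bar> \<le> 1/100" and t: "2/3 \<le> t" "t \<le> 1"
  shows "t * (s\<^sup>2 / 2 + nu * (1 - m) + m * (m + 1) / 2) - log_stirling m \<le> - d + 3"
proof -
  define u where "u = m - s"
  have u: "0 \<le> u" "u \<le> 1" using m by (auto simp: u_def)
  have 1: "(m + 1/2) * ln (m / s) \<ge> 0"
    using s m by (intro mult_nonneg_nonneg ln_ge_zero) auto
  have 2: "t * (u\<^sup>2 / 2 - u) \<le> 0"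
  proof -
    have "u\<^sup>2 \<le> u" using u by (simp add: power2_eq_square mult_left_le)
    then show ?thesis using u t by (intro mult_nonneg_nonpos) auto
  qed
  have 3: "(1 - u) * (e / s) \<le> 1/100"
  proof -
    have "(1 - u) * (e / s) \<le> (1 - u) * (1/100)"
      using abs_le_D1[OF e] u by (intro mult_left_mono) auto
    also have "\<dots> \<le> 1/100" using u by simp
    finally show ?thesis .
  qed
  have "t * (s\<^sup>2 / 2 + nu * (1 - m) + m * (m + 1) / 2) - log_stirling m =
     t * (u\<^sup>2 / 2 - u) + 3/2 * t + 1 - d + (1 - u) * (e / s) - (m + 1/2) * ln (m / s)"
    unfolding u_def by (rule saddle_identity) (use assms s in auto)
  then show ?thesis
    using 1 2 3 t by linarith
qed

definition upper_edge :: "real \<Rightarrow> nat \<Rightarrow> real" where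
  "upper_edge C n = k_h n - C / sqrt (ln (real n))"

text \<open>
  The shape required by \<open>saddle_identity\<close>. The iterated logarithms in \<open>k_h\<close> are expressed by
  \<open>s = sqrt (2 * log 2 n)\<close>, and the remaining constants are collected in \<open>d\<close>.
\<close>

lemma upper_edge_eq:
  fixes n :: nat and C :: real
  defines "s \<equiv> sqrt (2 * log 2 (real n))"
    and "d \<equiv> - 3/4 * ln (ln 2 / 2) - C * sqrt (2 * ln 2)"
  assumes n: "n \<ge> 3"
  shows "ln 2 * (upper_edge C n - log 2 (real n)) =
    ln 2 * s - ln s + 3/2 * ln 2 + 1 + (d - 3/2 * ln s) / s"
proof -
  define t where "t = ln (2::real)"
  have t: "t > 0" by (simp add: t_def)
  have logn: "log 2 (real n) > 0" using n by simp
  have s: "s > 0" using logn by (simp add: s_def)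
  have s2: "log 2 (real n) = s\<^sup>2 / 2"
    using logn by (simp add: s_def)
  have lnn: "ln (real n) = t / 2 * s\<^sup>2"
    using s2 t by (simp add: log_def t_def field_simps)
  have lnlnn: "ln (ln (real n)) = ln (t / 2) + 2 * ln s"
    unfolding lnn using t s by (simp add: ln_mult ln_realpow ln_div)
  have sq1: "sqrt (2 * ln (real n) * t) = t * s"
    unfolding lnn using t s by (intro real_sqrt_unique) (auto simp: power2_eq_square)
  have sq2: "sqrt (ln (real n)) = sqrt (t / 2) * s"
    unfolding lnn real_sqrt_mult using s by simp
  have ll: "log 2 (log 2 (real n)) = 2 * ln s / t - 1"
    unfolding s2 using s t by (simp add: log_def ln_div ln_realpow t_def[symmetric] diff_divide_distrib)
  have sqt: "sqrt (2 * t) * sqrt (t / 2) = t"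
    using t by (simp flip: real_sqrt_mult)
  have C: "t * (C / sqrt (ln (real n))) = C * sqrt (2 * t) / s"
    unfolding sq2 using t s sqt by (simp add: field_simps)
  have "t * (upper_edge C n - log 2 (real n)) =
     t * (s - 1/2 * (2 * ln s / t - 1) + 1 + 1 / t - 3 * (ln (t / 2) + 2 * ln s) / (4 * (t * s)))
     - t * (C / sqrt (ln (real n)))"
    unfolding upper_edge_def k_h_def ll sq1 lnlnn t_def[symmetric] s_def[symmetric]
    by (simp add: algebra_simps)
  also have "\<dots> = t * s - ln s + 3/2 * t + 1 + (d - 3/2 * ln s) / s"
    unfolding C d_def t_def[symmetric] using t s by (simp add: field_simps)
  finally show ?thesis by (simp only: t_def)
qed

text \<open>
  With \<open>x = k\<close> this is \<open>2 ^ k\<close> times \<open>n ^ m / m!\<close> times the probabilities of the last \<open>m\<close> jumps before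
  state \<open>k\<close>. A real argument \<open>x\<close> allows evaluation at the edge itself.
\<close>

definition jump_bound :: "nat \<Rightarrow> nat \<Rightarrow> real \<Rightarrow> real" where
  "jump_bound n m x = 2 powr (x * (1 - real m) + real m * (real m + 1) / 2) * (real n ^ m / fact m)"

lemma ln_jump_bound:
  assumes "n \<ge> 1"
  shows "ln (jump_bound n m (log 2 (real n) + nu)) =
    ln 2 * (log 2 (real n) + nu * (1 - real m) + real m * (real m + 1) / 2) - ln (fact m)"
proof -
  have A: "ln (jump_bound n m x) = ln 2 * (x * (1 - real m) + real m * (real m + 1) / 2) + real m * ln (real n) - ln (fact m)" for x
    using assms by (simp add: jump_bound_def ln_mult ln_div ln_realpow mult.commute)
  have B: "ln (real n) = ln 2 * log 2 (real n)"
    by (simp add: log_def)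
  show ?thesis
    unfolding A B by (simp add: algebra_simps)
qed

lemma jump_bound_pos: "n \<ge> 1 \<Longrightarrow> jump_bound n m x > 0"
  by (simp add: jump_bound_def)

lemma jump_bound_antimono: "m \<ge> 1 \<Longrightarrow> x \<le> y \<Longrightarrow> jump_bound n m y \<le> jump_bound n m x"
  unfolding jump_bound_def by (intro mult_right_mono powr_mono) (auto intro: mult_right_mono_neg)

lemma eventually_edge_error_small:
  fixes d :: real
  shows "\<forall>\<^sub>F n in sequentially. \<bar>(d - 3/2 * ln (sqrt (2 * log 2 (real n)))) / sqrt (2 * log 2 (real n))\<bar> \<le> 1/100"
    and "\<forall>\<^sub>F n in sequentially. sqrt (2 * log 2 (real n)) \<ge> 100"
proof -
  have s: "filterlim (\<lambda>n. sqrt (2 * log 2 (real n))) at_top sequentially"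
    by real_asymp
  have "((\<lambda>s. (d - 3/2 * ln s) / s) \<longlongrightarrow> 0) at_top"
    by real_asymp
  from tendstoD[OF filterlim_compose[OF this s], of "1/100"]
  show "\<forall>\<^sub>F n in sequentially. \<bar>(d - 3/2 * ln (sqrt (2 * log 2 (real n)))) / sqrt (2 * log 2 (real n))\<bar> \<le> 1/100"
    by (auto simp: dist_real_def elim: eventually_mono)
  show "\<forall>\<^sub>F n in sequentially. sqrt (2 * log 2 (real n)) \<ge> 100"
    using s by (auto simp: filterlim_at_top)
qed

text \<open>
  The constant \<open>K\<close> does not depend on \<open>C\<close>, so the bound can be made large by the choice of \<open>C\<close>.
\<close>

lemma jump_bound_edge_lower:
  "\<exists>K>0. \<forall>C. \<forall>\<^sub>F n in sequentially. \<forall>m\<ge>1. K * exp (C * sqrt (2 * ln 2)) \<le> jump_bound n m (upper_edge C n)"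
proof (intro exI[of _ "exp (3/4 * ln (ln 2 / 2) - 6)"] conjI allI)
  fix C :: real
  define d where "d = - 3/4 * ln (ln 2 / 2) - C * sqrt (2 * ln 2)"
  show "\<forall>\<^sub>F n in sequentially. \<forall>m\<ge>1. exp (3/4 * ln (ln 2 / 2) - 6) * exp (C * sqrt (2 * ln 2)) \<le> jump_bound n m (upper_edge C n)"
    using eventually_edge_error_small(1)[of d] eventually_edge_error_small(2) eventually_ge_at_top[of 3]
  proof eventually_elim
    case (elim n)
    show ?case
    proof (intro allI impI)
      fix m :: nat assume m: "m \<ge> 1"
      define s where "s = sqrt (2 * log 2 (real n))"
      define nu where "nu = upper_edge C n - log 2 (real n)"
      have n: "n \<ge> 3" using elim by simp
      have nu: "ln 2 * nu = ln 2 * s - ln s + 3/2 * ln 2 + 1 + (d - 3/2 * ln s) / s"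
        unfolding nu_def s_def d_def by (rule upper_edge_eq[OF n])
      have s2: "s\<^sup>2 / 2 = log 2 (real n)"
        using n by (simp add: s_def)
      have "- d - 5 \<le> ln 2 * (s\<^sup>2 / 2 + nu * (1 - real m) + real m * (real m + 1) / 2) - log_stirling (real m)"
        by (rule saddle_lower[OF _ _ nu refl]) (use elim m ln2_ge_two_thirds ln_2_less_1 in \<open>auto simp: s_def\<close>)
      also have "\<dots> \<le> ln (jump_bound n m (upper_edge C n)) + 1"
        using ln_jump_bound[of n m nu] n ln_fact_bounds(2)[OF m] by (simp add: nu_def s2)
      finally have "- d - 6 \<le> ln (jump_bound n m (upper_edge C n))" by simp
      then have "exp (- d - 6) \<le> jump_bound n m (upper_edge C n)"
        using n by (simp add: ln_ge_iff jump_bound_pos)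
      then show "exp (3/4 * ln (ln 2 / 2) - 6) * exp (C * sqrt (2 * ln 2)) \<le> jump_bound n m (upper_edge C n)"
        by (simp add: d_def exp_add[symmetric] algebra_simps)
    qed
  qed
qed simp

text \<open>
  The minimiser of the quadratic is within a bounded distance of \<open>s = sqrt (2 * log 2 n)\<close>, so rounding
  \<open>s\<close> up is good enough.
\<close>

lemma jump_bound_edge_upper:
  "\<exists>K>0. \<forall>C. \<forall>\<^sub>F n in sequentially.
     jump_bound n (nat \<lceil>sqrt (2 * log 2 (real n))\<rceil>) (upper_edge C n) \<le> K * exp (C * sqrt (2 * ln 2))"
proof (intro exI[of _ "exp (3/4 * ln (ln 2 / 2) + 3)"] conjI allI)
  fix C :: real
  define d where "d = - 3/4 * ln (ln 2 / 2) - C * sqrt (2 * ln 2)"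
  show "\<forall>\<^sub>F n in sequentially. jump_bound n (nat \<lceil>sqrt (2 * log 2 (real n))\<rceil>) (upper_edge C n)
      \<le> exp (3/4 * ln (ln 2 / 2) + 3) * exp (C * sqrt (2 * ln 2))"
    using eventually_edge_error_small(1)[of d] eventually_edge_error_small(2) eventually_ge_at_top[of 3]
  proof eventually_elim
    case (elim n)
    define s where "s = sqrt (2 * log 2 (real n))"
    define m where "m = nat \<lceil>s\<rceil>"
    define nu where "nu = upper_edge C n - log 2 (real n)"
    have n: "n \<ge> 3" using elim by simp
    have nu: "ln 2 * nu = ln 2 * s - ln s + 3/2 * ln 2 + 1 + (d - 3/2 * ln s) / s"
      unfolding nu_def s_def d_def by (rule upper_edge_eq[OF n])
    have s2: "s\<^sup>2 / 2 = log 2 (real n)"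
      using n by (simp add: s_def)
    have s: "s \<ge> 100" using elim by (simp add: s_def)
    have m: "s \<le> real m" "real m \<le> s + 1" "m \<ge> 1"
      using s by (auto simp: m_def) linarith+
    have "ln (jump_bound n m (upper_edge C n))
        \<le> ln 2 * (s\<^sup>2 / 2 + nu * (1 - real m) + real m * (real m + 1) / 2) - log_stirling (real m)"
      using ln_jump_bound[of n m nu] n ln_fact_bounds(1)[OF m(3)] by (simp add: nu_def s2)
    also have "\<dots> \<le> - d + 3"
      by (rule saddle_upper[OF _ _ _ nu refl]) (use elim m s ln2_ge_two_thirds ln_2_less_1 in \<open>auto simp: s_def\<close>)
    finally have "jump_bound n m (upper_edge C n) \<le> exp (- d + 3)"
      using jump_bound_pos[of n m "upper_edge C n"] n by (metis exp_le_cancel_iff exp_ln le_trans one_le_numeral)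
    then show ?case
      by (simp add: d_def m_def s_def exp_add[symmetric] algebra_simps)
  qed
qed simp

lemma prod_half_powers:
  "(\<Prod>i\<in>{a..<a + m}. (1/2 :: real) ^ i) = 2 powr - (real m * real a + real m * (real m - 1) / 2)"
proof (induction m)
  case (Suc m)
  have "(1/2 :: real) ^ (a + m) = 2 powr - real (a + m)"
    by (simp only: powr_minus powr_realpow zero_less_numeral) (simp add: power_one_over inverse_eq_divide)
  then have "(\<Prod>i\<in>{a..<a + Suc m}. (1/2 :: real) ^ i)
      = 2 powr (- (real m * real a + real m * (real m - 1) / 2) + - real (a + m))"
    using Suc by (simp add: powr_add)
  also have "- (real m * real a + real m * (real m - 1) / 2) + - real (a + m)
      = - (real (Suc m) * real a + real (Suc m) * (real (Suc m) - 1) / 2)"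
    by (simp add: field_simps)
  finally show ?case .
qed simp

lemma two_power_mult_prod_half_powers:
  "2 ^ (a + m) * (real n ^ m / fact m * (\<Prod>i\<in>{a..<a + m}. (1/2) ^ i)) = jump_bound n m (real (a + m))"
proof -
  have "2 ^ (a + m) * (\<Prod>i\<in>{a..<a + m}. (1/2 :: real) ^ i)
      = 2 powr (real (a + m) + - (real m * real a + real m * (real m - 1) / 2))"
    unfolding prod_half_powers powr_add by (simp only: powr_realpow zero_less_numeral)
  also have "real (a + m) + - (real m * real a + real m * (real m - 1) / 2)
      = real (a + m) * (1 - real m) + real m * (real m + 1) / 2"
    by (simp add: field_simps)
  finally have "2 ^ (a + m) * (\<Prod>i\<in>{a..<a + m}. (1/2 :: real) ^ i) * (real n ^ m / fact m) = jump_bound n m (real (a + m))"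
    by (simp only: jump_bound_def)
  then show ?thesis
    by (simp only: mult_ac)
qed

lemma mean_le_jump_bound:
  assumes "m \<le> k"
  shows "profile_mean k n \<le> jump_bound n m (real k)"
proof -
  define a where "a = k - m"
  have k: "k = a + m" using assms by (simp add: a_def)
  have "real (n choose m) * fact m \<le> real n ^ m"
    using of_nat_mono[OF binomial_fact_pow[of n m], where 'a = real] by simp
  then have "real (n choose m) \<le> real n ^ m / fact m"
    by (simp add: field_simps)
  then have "real (n choose m) * (\<Prod>i\<in>{a..<a + m}. (1/2) ^ i) \<le> real n ^ m / fact m * (\<Prod>i\<in>{a..<a + m}. (1/2) ^ i)"
    by (intro mult_right_mono prod_nonneg) auto
  with depth_prob_le_choose[of n a m]
  have "depth_prob n (a + m) \<le> real n ^ m / fact m * (\<Prod>i\<in>{a..<a + m}. (1/2) ^ i)"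
    by linarith
  then have "2 ^ (a + m) * depth_prob n (a + m) \<le> jump_bound n m (real (a + m))"
    unfolding two_power_mult_prod_half_powers[symmetric] by (intro mult_left_mono) auto
  then show ?thesis
    by (simp add: profile_mean_eq k)
qed

text \<open>
  Take the least \<open>m\<close> with \<open>4 * m * 2 ^ (k - m) \<le> n\<close>. By minimality, and as \<open>2 ^ k > n / 2\<close> excludes
  \<open>m = 1\<close>, the two sides differ at most by a factor 2, as required by \<open>depth_prob_ge_power\<close>. Since \<open>k\<close>
  is at most logarithmic, \<open>m = k\<close> satisfies the condition, so the least one exists.
\<close>

lemma eventually_mean_ge_jump_bound:
  "\<forall>\<^sub>F n in sequentially. \<forall>k. n < 2 * 2 ^ k \<and> real k \<le> 2 * log 2 (real n) \<longrightarrow>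
     (\<exists>m\<ge>1. exp (-38) / 2 * jump_bound n m (real k) \<le> profile_mean k n)"
proof -
  have "\<forall>\<^sub>F n in sequentially. 32 * log 2 (real n) \<le> real n"
    by real_asymp
  moreover have "\<forall>\<^sub>F n in sequentially. 2 * (2 * log 2 (real n))\<^sup>2 \<le> real n"
    by real_asymp
  ultimately show ?thesis
    using eventually_ge_at_top[of 3]
  proof eventually_elim
    case (elim n)
    show ?case
    proof (intro allI impI)
      fix k assume "n < 2 * 2 ^ k \<and> real k \<le> 2 * log 2 (real n)"
      then have kn: "n < 2 * 2 ^ k" "real k \<le> 2 * log 2 (real n)" by auto
      have "k \<ge> 1" using kn(1) elim by (cases k) auto
      have "real (16 * k) \<le> real n"
        using kn(2) elim by simp
      then have k16: "16 * k \<le> n" by (simp only: of_nat_le_iff)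
      have "2 * (real k)\<^sup>2 \<le> real n"
        using elim(2) power_mono[OF kn(2), of 2] by simp
      then have "real (2 * k\<^sup>2) \<le> real n" by simp
      then have k2: "2 * k\<^sup>2 \<le> n" by (simp only: of_nat_le_iff)
      define P where "P = (\<lambda>m. m \<ge> 1 \<and> m \<le> k \<and> 4 * m * 2 ^ (k - m) \<le> n)"
      have "P k" using k16 \<open>k \<ge> 1\<close> by (simp add: P_def)
      define m where "m = (LEAST m. P m)"
      have m: "m \<ge> 1" "m \<le> k" "4 * m * 2 ^ (k - m) \<le> n"
        using LeastI[of P, OF \<open>P k\<close>] by (auto simp: m_def P_def)
      have "\<not> P (m - 1)"
        using m(1) by (intro not_less_Least) (simp add: m_def[symmetric])
      have "m \<noteq> 1"
      proof
        assume "m = 1"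
        then have "4 * 2 ^ (k - 1) \<le> n" using m(3) by simp
        moreover have "(2::nat) * 2 ^ k = 4 * 2 ^ (k - 1)"
          using \<open>k \<ge> 1\<close> by (cases k) auto
        ultimately show False using kn(1) by simp
      qed
      with m(1) have m2: "m \<ge> 2" by simp
      have upper: "n \<le> 8 * m * 2 ^ (k - m)"
      proof -
        have "n < 4 * (m - 1) * 2 ^ (k - (m - 1))"
          using \<open>\<not> P (m - 1)\<close> m2 m(2) by (auto simp: P_def)
        also have "k - (m - 1) = Suc (k - m)"
          using m2 m(2) by simp
        also have "4 * (m - 1) * 2 ^ Suc (k - m) \<le> 8 * m * 2 ^ (k - m)"
          by simp
        finally show ?thesis by simp
      qed
      have "k - m \<ge> 1"
      proof (rule ccontr)
        assume "\<not> 1 \<le> k - m"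
        then have "n \<le> 8 * m" using upper by simp
        then show False using k16 m(2) m2 by linarith
      qed
      moreover have "2 * m\<^sup>2 \<le> n"
        using k2 power_mono[OF m(2), of 2] by linarith
      ultimately have "exp (-38) / 2 * (real n ^ m / fact m * (\<Prod>i\<in>{k - m..<k - m + m}. (1/2) ^ i)) \<le> depth_prob n (k - m + m)"
        using m m2 upper by (intro depth_prob_ge_power) auto
      then have "2 ^ (k - m + m) * (exp (-38) / 2 * (real n ^ m / fact m * (\<Prod>i\<in>{k - m..<k - m + m}. (1/2) ^ i)))
          \<le> 2 ^ (k - m + m) * depth_prob n (k - m + m)"
        by (rule mult_left_mono) simp
      then have "exp (-38) / 2 * jump_bound n m (real (k - m + m)) \<le> 2 ^ (k - m + m) * depth_prob n (k - m + m)"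
        unfolding two_power_mult_prod_half_powers[symmetric] by (simp only: mult_ac)
      then show "\<exists>m\<ge>1. exp (-38) / 2 * jump_bound n m (real k) \<le> profile_mean k n"
        using m by (auto simp: profile_mean_eq intro!: exI[of _ m])
    qed
  qed
qed

text \<open>
  One number \<open>m\<close> of jumps serves all levels beyond the edge, because \<open>jump_bound\<close> decreases with the level.
\<close>

lemma mean_bounded_above_upper_edge:
  "\<exists>K>0. \<forall>C. \<forall>\<^sub>F n in sequentially. \<forall>k. upper_edge C n \<le> real k \<longrightarrow>
     profile_mean k n \<le> K * exp (C * sqrt (2 * ln 2))"
proof -
  obtain K where K: "K > 0" "\<And>C. \<forall>\<^sub>F n in sequentially.
     jump_bound n (nat \<lceil>sqrt (2 * log 2 (real n))\<rceil>) (upper_edge C n) \<le> K * exp (C * sqrt (2 * ln 2))"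
    using jump_bound_edge_upper by blast
  have "\<forall>\<^sub>F n in sequentially. \<forall>k. upper_edge C n \<le> real k \<longrightarrow>
     profile_mean k n \<le> K * exp (C * sqrt (2 * ln 2))" for C
  proof -
    \<comment> \<open>this ensures that the number of jumps is at most the level\<close>
    have "\<forall>\<^sub>F n in sequentially. sqrt (2 * log 2 (real n)) + 1 \<le> upper_edge C n"
      unfolding upper_edge_def k_h_def by real_asymp
    with K(2)[of C] eventually_ge_at_top[of 3] show ?thesis
    proof eventually_elim
      case (elim n)
      show ?case
      proof (intro allI impI)
        fix k assume k: "upper_edge C n \<le> real k"
        define m where "m = nat \<lceil>sqrt (2 * log 2 (real n))\<rceil>"
        have pos: "sqrt (2 * log 2 (real n)) > 0" using elim by simp
        then have "real m = of_int \<lceil>sqrt (2 * log 2 (real n))\<rceil>"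
          by (simp add: m_def)
        then have m: "m \<ge> 1" "real m \<le> sqrt (2 * log 2 (real n)) + 1"
          using pos ceiling_correct[of "sqrt (2 * log 2 (real n))"] by linarith+
        have "profile_mean k n \<le> jump_bound n m (real k)"
          using m(2) k elim by (intro mean_le_jump_bound) linarith
        also have "\<dots> \<le> jump_bound n m (upper_edge C n)"
          by (rule jump_bound_antimono[OF m(1) k])
        finally show "profile_mean k n \<le> K * exp (C * sqrt (2 * ln 2))"
          using elim(1) by (simp add: m_def)
      qed
    qed
  qed
  with K(1) show ?thesis by blast
qed

text \<open>
  The number \<open>m\<close> of jumps depends on the level \<open>k\<close> and is not known at the edge. As \<open>jump_bound n m\<close>
  decreases with the level, it is at least its value at the edge, where the bound holds for every \<open>m\<close>.
\<close>

lemma mean_large_below_upper_edge: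
  "\<exists>K>0. \<forall>C. \<forall>\<^sub>F n in sequentially. \<forall>k. n < 2 * 2 ^ k \<and> real k \<le> upper_edge C n \<longrightarrow>
     K * exp (C * sqrt (2 * ln 2)) \<le> profile_mean k n"
proof -
  obtain K where K: "K > 0" "\<And>C. \<forall>\<^sub>F n in sequentially. \<forall>m\<ge>1.
     K * exp (C * sqrt (2 * ln 2)) \<le> jump_bound n m (upper_edge C n)"
    using jump_bound_edge_lower by blast
  have "\<forall>\<^sub>F n in sequentially. \<forall>k. n < 2 * 2 ^ k \<and> real k \<le> upper_edge C n \<longrightarrow>
     exp (-38) / 2 * K * exp (C * sqrt (2 * ln 2)) \<le> profile_mean k n" for C
  proof -
    have "\<forall>\<^sub>F n in sequentially. upper_edge C n \<le> 2 * log 2 (real n)"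
      unfolding upper_edge_def k_h_def by real_asymp
    with K(2)[of C] eventually_mean_ge_jump_bound show ?thesis
    proof eventually_elim
      case (elim n)
      show ?case
      proof (intro allI impI)
        fix k assume k: "n < 2 * 2 ^ k \<and> real k \<le> upper_edge C n"
        then obtain m where m: "m \<ge> 1" "exp (-38) / 2 * jump_bound n m (real k) \<le> profile_mean k n"
          using elim by force
        have "K * exp (C * sqrt (2 * ln 2)) \<le> jump_bound n m (upper_edge C n)"
          using elim(1) m(1) by blast
        also have "\<dots> \<le> jump_bound n m (real k)"
          using k by (intro jump_bound_antimono m) auto
        finally have "exp (-38) / 2 * (K * exp (C * sqrt (2 * ln 2))) \<le> exp (-38) / 2 * jump_bound n m (real k)"
          by (intro mult_left_mono) auto
        with m(2) show "exp (-38) / 2 * K * exp (C * sqrt (2 * ln 2)) \<le> profile_mean k n"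
          unfolding mult.assoc by linarith
      qed
    qed
  qed
  with K(1) show ?thesis
    by (intro exI[of _ "exp (-38) / 2 * K"]) auto
qed

section \<open>The window in which both moments diverge\<close>

theorem corollary2:
  fixes k :: "nat \<Rightarrow> nat"
  assumes "\<And>n. k n \<le> n"
  shows "(filterlim (\<lambda>n. prob_space.expectation bit_space (external_profile n (k n))) at_top sequentially \<and>
          filterlim (\<lambda>n. prob_space.variance bit_space (external_profile n (k n))) at_top sequentially)
    \<longleftrightarrow>
      (\<exists>\<omega> :: nat \<Rightarrow> real. (\<forall>n. \<omega> n > 0) \<and> filterlim \<omega> at_top sequentially \<and>
         (\<forall>\<^sub>F n in sequentially.
            k_s n + \<omega> n / ln (real n) \<le> real (k n) \<and>
            real (k n) \<le> k_h n - \<omega> n / sqrt (ln (real n))))"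
    (is "?moments \<longleftrightarrow> ?window")
proof -
  define g :: real where "g = sqrt (2 * ln 2)"
  have g: "g > 0" by (simp add: g_def)
  have ln_pos: "\<forall>\<^sub>F n in sequentially. ln (real n) > 0"
    by real_asymp
  have ?window if ?moments
  proof -
    from that have mean: "filterlim (\<lambda>n. profile_mean (k n) n) at_top sequentially"
      by (simp only: expectation_external_profile)
    obtain K where K: "K > 0" "\<And>C. \<forall>\<^sub>F n in sequentially. \<forall>k. upper_edge C n \<le> real k \<longrightarrow>
        profile_mean k n \<le> K * exp (C * g)"
      unfolding g_def using mean_bounded_above_upper_edge by blast
    define lo where "lo = (\<lambda>n. (real (k n) - k_s n) * ln (real n))"
    define hi where "hi = (\<lambda>n. (k_h n - real (k n)) * sqrt (ln (real n)))"
    \<comment> \<open>the maximum only matters for small \<open>n\<close>, where positivity could fail\<close>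
    define \<omega> where "\<omega> = (\<lambda>n. max 1 (min (lo n) (hi n)))"
    have window: "\<forall>\<^sub>F n in sequentially. C \<le> min (lo n) (hi n)" for C
    proof -
      have "\<forall>\<^sub>F n in sequentially. 8 * 2 powr C < profile_mean (k n) n"
        "\<forall>\<^sub>F n in sequentially. K * exp (C * g) < profile_mean (k n) n"
        using mean by (auto simp: filterlim_at_top_dense)
      with mean_bounded_below_lower_edge[of C] K(2)[of C] ln_pos show ?thesis
      proof eventually_elim
        case (elim n)
        have "lower_edge C n < real (k n)"
          using elim by (meson not_le)
        then have "C / ln (real n) \<le> real (k n) - k_s n"
          by (simp add: lower_edge_def)
        then have "C \<le> lo n"
          unfolding lo_def using elim by (subst (asm) pos_divide_le_eq) auto
        have "real (k n) < upper_edge C n"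
          using elim by (meson not_le)
        then have "C / sqrt (ln (real n)) \<le> k_h n - real (k n)"
          by (simp add: upper_edge_def)
        then have "C \<le> hi n"
          unfolding hi_def using elim by (subst (asm) pos_divide_le_eq) auto
        with \<open>C \<le> lo n\<close> show ?case by simp
      qed
    qed
    have "filterlim \<omega> at_top sequentially"
      unfolding filterlim_at_top
    proof
      fix C :: real
      show "\<forall>\<^sub>F n in sequentially. C \<le> \<omega> n"
        using window[of C] by eventually_elim (simp add: \<omega>_def le_max_iff_disj)
    qed
    moreover have "\<forall>\<^sub>F n in sequentially. k_s n + \<omega> n / ln (real n) \<le> real (k n) \<and>
        real (k n) \<le> k_h n - \<omega> n / sqrt (ln (real n))"
      using window[of 1] ln_pos
    proof eventually_elim
      case (elim n)
      have "\<omega> n \<le> lo n" "\<omega> n \<le> hi n"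
        using elim(1) by (auto simp: \<omega>_def)
      then have "\<omega> n / ln (real n) \<le> real (k n) - k_s n" "\<omega> n / sqrt (ln (real n)) \<le> k_h n - real (k n)"
        using elim(2) by (auto simp: lo_def hi_def pos_divide_le_eq)
      then show ?case by simp
    qed
    moreover have "\<forall>n. \<omega> n > 0"
      by (simp add: \<omega>_def less_max_iff_disj)
    ultimately show ?thesis by blast
  qed
  moreover have ?moments if ?window
  proof -
    from that obtain \<omega> where \<omega>: "filterlim \<omega> at_top sequentially"
      and win: "\<forall>\<^sub>F n in sequentially. k_s n + \<omega> n / ln (real n) \<le> real (k n) \<and>
        real (k n) \<le> k_h n - \<omega> n / sqrt (ln (real n))"
      by blast
    obtain K where K: "K > 0" "\<And>C. \<forall>\<^sub>F n in sequentially. \<forall>k. n < 2 * 2 ^ k \<and> real k \<le> upper_edge C n \<longrightarrow>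
        K * exp (C * g) \<le> profile_mean k n"
      unfolding g_def using mean_large_below_upper_edge by blast
    have inside: "\<forall>\<^sub>F n in sequentially. lower_edge C n \<le> real (k n) \<and> real (k n) \<le> upper_edge C n" for C
    proof -
      have "\<forall>\<^sub>F n in sequentially. C \<le> \<omega> n"
        using \<omega> by (auto simp: filterlim_at_top)
      with win ln_pos show ?thesis
      proof eventually_elim
        case (elim n)
        have "C / ln (real n) \<le> \<omega> n / ln (real n)" "C / sqrt (ln (real n)) \<le> \<omega> n / sqrt (ln (real n))"
          using elim by (auto intro!: divide_right_mono)
        with elim show ?case
          unfolding lower_edge_def upper_edge_def by linarith
      qed
    qed
    have mean: "filterlim (\<lambda>n. profile_mean (k n) n) at_top sequentially"
      unfolding filterlim_at_top_gt[where c = 0]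
    proof (intro allI impI)
      fix Z :: real assume Z: "Z > 0"
      \<comment> \<open>large enough for both edges\<close>
      define C where "C = max (log 2 (4 * Z)) (ln (Z / K) / g)"
      have "4 * Z = 2 powr log 2 (4 * Z)" using Z by simp
      also have "\<dots> \<le> 2 powr C" by (intro powr_mono) (auto simp: C_def)
      finally have C1: "Z \<le> 2 powr C / 4" by simp
      have "ln (Z / K) = ln (Z / K) / g * g" using g by simp
      also have "\<dots> \<le> C * g" using g by (intro mult_right_mono) (auto simp: C_def)
      finally have "Z / K \<le> exp (C * g)"
        using Z K(1) by (metis divide_pos_pos exp_le_cancel_iff exp_ln)
      then have C2: "Z \<le> K * exp (C * g)"
        using K(1) by (simp add: field_simps)
      show "\<forall>\<^sub>F n in sequentially. Z \<le> profile_mean (k n) n"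
        using inside[of C] mean_large_above_lower_edge[of C] K(2)[of C]
      proof eventually_elim
        case (elim n)
        show ?case
        proof (cases "2 * 2 ^ k n \<le> n")
          case True
          then have "2 powr C / 4 \<le> profile_mean (k n) n" using elim by blast
          with C1 show ?thesis by linarith
        next
          case False
          then have "K * exp (C * g) \<le> profile_mean (k n) n" using elim by (simp add: not_le)
          with C2 show ?thesis by linarith
        qed
      qed
    qed
    obtain c where c: "c > 0" "\<And>k n. k \<ge> 3 \<Longrightarrow> c * profile_mean k n \<le> profile_var k n"
      using profile_var_ge_mean by blast
    have "\<forall>\<^sub>F n in sequentially. lower_edge 0 n \<ge> 3"
      unfolding lower_edge_def k_s_def by real_asymp
    with inside[of 0] have "\<forall>\<^sub>F n in sequentially. c * profile_mean (k n) n \<le> profile_var (k n) n"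
      by eventually_elim (intro c(2), linarith)
    moreover have "filterlim (\<lambda>n. c * profile_mean (k n) n) at_top sequentially"
      using c(1) mean by (intro filterlim_tendsto_pos_mult_at_top[OF tendsto_const])
    ultimately have "filterlim (\<lambda>n. profile_var (k n) n) at_top sequentially"
      by (rule filterlim_at_top_mono[rotated])
    with mean show ?thesis
      by (simp only: variance_external_profile) (simp only: expectation_external_profile)
  qed
  ultimately show ?thesis by blast
qed

end
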